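(* Let $J=J_0\oplus J_1$ be a nilpotent Jordan superalgebra over $\mathbb{C}$ of type $(3,2)$. Then $J$ is isomorphic to one of the following pairwise non-isomorphic nilpotent Jordan superalgebras, each given on a homogeneous basis $\{e_1,e_2,e_3\}\cup\{f_1,f_2\}$ ($e_i$ even, $f_j$ odd) by its multiplication table: \begin{itemize} \item $(3,2)_{1}$: all products are zero; \item $(3,2)_{2}$: $f_1f_2=e_2$; \item $(3,2)_{3}$: $e_1f_2=f_1$; \item $(3,2)_{4}$: $e_1f_2=f_1,\ f_1f_2=e_2$; \item $(3,2)_{5}$: $e_1^2=e_2$; \item $(3,2)_{6}$: $e_1^2=e_2,\ f_1f_2=e_1$; \item $(3,2)_{7}$: $e_1^2=e_2,\ f_1f_2=e_2$; \item $(3,2)_{8}$: $e_1^2=e_2,\ f_1f_2=e_3$; \item $(3,2)_{9}$: $e_1^2=e_2,\ e_2f_2=f_1$; \item $(3,2)_{10}$: $e_1^2=e_2,\ e_3f_2=f_1$; \item $(3,2)_{11}$: $e_1^2=e_2,\ e_3f_2=f_1,\ f_1f_2=e_2$; \item $(3,2)_{12}$: $e_1^2=e_2,\ e_1f_2=f_1$; \item $(3,2)_{13}$: $e_1^2=e_2,\ e_1f_2=f_1,\ f_1f_2=e_2$; \item $(3,2)_{14}$: $e_1^2=e_2,\ e_1f_2=f_1,\ f_1f_2=e_3$; \item $(3,2)_{15}$: $e_1e_2=e_3$; \item $(3,2)_{16}$: $e_1e_2=e_3,\ f_1f_2=e_1$; \item $(3,2)_{17}$: $e_1e_2=e_3,\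 f_1f_2=e_3$; \item $(3,2)_{18}$: $e_1e_2=e_3,\ f_1f_2=e_1+e_2$; \item $(3,2)_{19}$: $e_1e_2=e_3,\ e_3f_2=f_1$; \item $(3,2)_{20}$: $e_1e_2=e_3,\ e_1f_2=f_1$; \item $(3,2)_{21}$: $e_1e_2=e_3,\ e_1f_2=f_1,\ f_1f_2=e_3$; \item $(3,2)_{22}$: $e_1e_2=e_3,\ e_1f_2=e_2f_2=f_1$; \item $(3,2)_{23}$: $e_1e_2=e_3,\ e_1f_2=e_2f_2=f_1,\ f_1f_2=e_3$; \item $(3,2)_{24}$: $e_1^2=e_2,\ e_1e_2=e_3$; \item $(3,2)_{25}$: $e_1^2=e_2,\ e_1e_2=e_3,\ f_1f_2=e_2$; \item $(3,2)_{26}$: $e_1^2=e_2,\ e_1e_2=e_3,\ f_1f_2=e_3$; \item $(3,2)_{27}$: $e_1^2=e_2,\ e_1e_2=e_3,\ e_2f_2=f_1$; \item $(3,2)_{28}$: $e_1^2=e_2,\ e_1e_2=e_3,\ e_1f_2=f_1$; \item $(3,2)_{29}$: $e_1^2=e_2,\ e_1e_2=e_3,\ e_1f_2=f_1,\ f_1f_2=e_3$. \end{itemize}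
   Context: All vector spaces are over $\mathbb{C}$. A superalgebra $J=J_0\oplus J_1$ is a $\mathbb{Z}_2$-graded (not necessarily associative) algebra: $J_iJ_j\subseteq J_{i+j \bmod 2}$; $|x|=i$ denotes the parity of a nonzero $x\in J_i$. A Jordan superalgebra is a superalgebra satisfying, for all nonzero homogeneous $x,y,z,w$, supercommutativity $xy=(-1)^{|x||y|}yx$ and the Jordan superidentity $$(wx)(yz)+(-1)^{|x||y|}(wy)(xz)+(-1)^{(|x|+|y|)|z|}(wz)(xy)-(-1)^{|w||x|}x(w(yz))-(-1)^{|y|(|w|+|x|)}y(w(xz))-(-1)^{|z|(|w|+|x|+|y|)}z(w(xy))=0.$$ $J$ is of type $(m,n)$ if $\dim J_0=m$ and $\dim J_1=n$. Put $J^1=J$ and $J^{k+1}=J^kJ+J^{k-1}J^2+\cdots+JJ^k$ for $k\ge 1$; $J$ is nilpotent if $J^k=0$ for some $k\geq 1$. Two superalgebras are isomorphic if there is an algebra isomorphism between them preserving the grading (even part to even part, odd part to odd part). In multiplication tables, products of basis elements that are neither listed nor obtained from listed ones by supercommutativity ($e_if_j=f_je_i$, $f_if_j=-f_jf_i$, $e_ie_j=e_je_i$) are zero. *)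

theory Defs
  imports "HOL-Analysis.Analysis"
begin

text \<open>
  The underlying complex vector space is the whole type \<open>'a\<close>, with the
  addition of the type and the scalar multiplication given by the record.
\<close>

record 'a superalg =
  smul :: "complex \<Rightarrow> 'a \<Rightarrow> 'a"
  mul :: "'a \<Rightarrow> 'a \<Rightarrow> 'a"  (infixl "\<star>\<index>" 70)
  even_part :: "'a set"
  odd_part :: "'a set"

text \<open>The index is read modulo 2, so \<open>hpart A (i + j)\<close> is the component of degree i + j mod 2.\<close>

definition hpart :: "('a, 'b) superalg_scheme \<Rightarrow> nat \<Rightarrow> 'a set" where
  "hpart A i = (if even i then even_part A else odd_part A)"

locale superalgebra = vector_space "smul A"
  for A :: "'a::ab_group_add superalg" (structure) +
  assumes subspace_even: "subspace (even_part A)"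
    and subspace_odd: "subspace (odd_part A)"
    and parts_Int: "even_part A \<inter> odd_part A = {0}"
    and parts_sum: "\<And>x. \<exists>u\<in>even_part A. \<exists>v\<in>odd_part A. x = u + v"
    and linear_mul_right: "\<And>x. Vector_Spaces.linear (smul A) (smul A) (\<lambda>y. x \<star> y)"
    and linear_mul_left: "\<And>y. Vector_Spaces.linear (smul A) (smul A) (\<lambda>x. x \<star> y)"
    and graded: "\<And>i j x y. i \<in> {0, 1} \<Longrightarrow> j \<in> {0, 1} \<Longrightarrow>
      x \<in> hpart A i \<Longrightarrow> y \<in> hpart A j \<Longrightarrow> x \<star> y \<in> hpart A (i + j)"

text \<open>
  In the two axioms below p, q, r, s are the parities of w, x, y, z. The zero vector,
  which has no parity, is not excluded: if one of the arguments is 0, both axioms hold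
  by bilinearity.
\<close>

locale jordan_superalgebra = superalgebra +
  assumes supercommutative: "\<And>q r x y. q \<in> {0, 1} \<Longrightarrow> r \<in> {0, 1} \<Longrightarrow>
      x \<in> hpart A q \<Longrightarrow> y \<in> hpart A r \<Longrightarrow>
      x \<star> y = smul A ((-1) ^ (q * r)) (y \<star> x)"
    and jordan_superidentity: "\<And>p q r s w x y z.
      p \<in> {0, 1} \<Longrightarrow> q \<in> {0, 1} \<Longrightarrow> r \<in> {0, 1} \<Longrightarrow> s \<in> {0, 1} \<Longrightarrow>
      w \<in> hpart A p \<Longrightarrow> x \<in> hpart A q \<Longrightarrow> y \<in> hpart A r \<Longrightarrow> z \<in> hpart A s \<Longrightarrow>
      (w \<star> x) \<star> (y \<star> z)
      + smul A ((-1) ^ (q * r)) ((w \<star> y) \<star> (x \<star> z))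
      + smul A ((-1) ^ ((q + r) * s)) ((w \<star> z) \<star> (x \<star> y))
      - smul A ((-1) ^ (p * q)) (x \<star> (w \<star> (y \<star> z)))
      - smul A ((-1) ^ (r * (p + q))) (y \<star> (w \<star> (x \<star> z)))
      - smul A ((-1) ^ (s * (p + q + r))) (z \<star> (w \<star> (x \<star> y))) = 0"

text \<open>\<open>dim\<close> is 0 for infinite-dimensional spaces, so m and n are to be positive here.\<close>

definition has_type :: "'a::ab_group_add superalg \<Rightarrow> nat \<Rightarrow> nat \<Rightarrow> bool" where
  "has_type A m n \<longleftrightarrow>
     vector_space.dim (smul A) (even_part A) = m \<and> vector_space.dim (smul A) (odd_part A) = n"

definition subspace_mul :: "'a::ab_group_add superalg \<Rightarrow> 'a set \<Rightarrow> 'a set \<Rightarrow> 'a set" where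
  "subspace_mul A P Q = module.span (smul A) {mul A x y | x y. x \<in> P \<and> y \<in> Q}"

text \<open>
  The sum of the subspaces \<open>J\<^sup>i J\<^sup>k\<^sup>+\<^sup>1\<^sup>-\<^sup>i\<close>, for i from 1 to k = n + 1, is written as the
  span of their union. The value at exponent 0 is irrelevant.
\<close>

fun superalg_pow :: "'a::ab_group_add superalg \<Rightarrow> nat \<Rightarrow> 'a set" where
  "superalg_pow A 0 = UNIV"
| "superalg_pow A (Suc 0) = UNIV"
| "superalg_pow A (Suc (Suc n)) = module.span (smul A)
     (\<Union>i\<in>{1..Suc n}. subspace_mul A (superalg_pow A i) (superalg_pow A (Suc (Suc n) - i)))"

definition superalg_nilpotent :: "'a::ab_group_add superalg \<Rightarrow> bool" where
  "superalg_nilpotent A \<longleftrightarrow> (\<exists>k\<ge>1. superalg_pow A k = {0})"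

definition superalg_iso ::
  "'a::ab_group_add superalg \<Rightarrow> 'b::ab_group_add superalg \<Rightarrow> bool" where
  "superalg_iso A B \<longleftrightarrow>
     (\<exists>\<phi>. Vector_Spaces.linear (smul A) (smul B) \<phi> \<and> bij \<phi> \<and>
          (\<forall>x y. \<phi> (mul A x y) = mul B (\<phi> x) (\<phi> y)) \<and>
          \<phi> ` even_part A = even_part B \<and> \<phi> ` odd_part A = odd_part B)"

datatype gen = E1 | E2 | E3 | F1 | F2

lemma UNIV_gen: "(UNIV :: gen set) = {E1, E2, E3, F1, F2}"
  using gen.exhaust by blast

instance gen :: finite
  by standard (simp add: UNIV_gen)

abbreviation bv :: "gen \<Rightarrow> complex ^ gen" where
  "bv g \<equiv> axis g 1"

definition odd_gen :: "gen \<Rightarrow> bool" where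
  "odd_gen g \<longleftrightarrow> g \<in> {F1, F2}"

text \<open>A multiplication table lists products of basis vectors; supercommutativity supplies
  the products in the other order, and the remaining ones are 0.\<close>

type_synonym mul_table = "((gen \<times> gen) \<times> (complex ^ gen)) list"

definition gen_mul :: "mul_table \<Rightarrow> gen \<Rightarrow> gen \<Rightarrow> complex ^ gen" where
  "gen_mul T g h =
     (case map_of T (g, h) of
        Some v \<Rightarrow> v
      | None \<Rightarrow>
          (case map_of T (h, g) of
             Some v \<Rightarrow> (if odd_gen g \<and> odd_gen h then - v else v)
           | None \<Rightarrow> 0))"

definition table_superalg :: "mul_table \<Rightarrow> (complex ^ gen) superalg" where
  "table_superalg T =
     \<lparr>smul = (*s),
      mul = (\<lambda>x y. \<Sum>g\<in>UNIV. \<Sum>h\<in>UNIV. (x $ g * y $ h) *s gen_mul T g h),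
      even_part = {x. \<forall>g. odd_gen g \<longrightarrow> x $ g = 0},
      odd_part = {x. \<forall>g. \<not> odd_gen g \<longrightarrow> x $ g = 0}\<rparr>"

definition tables_3_2 :: "mul_table list" where
  "tables_3_2 =
    [[],
     [((F1, F2), bv E2)],
     [((E1, F2), bv F1)],
     [((E1, F2), bv F1), ((F1, F2), bv E2)],
     [((E1, E1), bv E2)],
     [((E1, E1), bv E2), ((F1, F2), bv E1)],
     [((E1, E1), bv E2), ((F1, F2), bv E2)],
     [((E1, E1), bv E2), ((F1, F2), bv E3)],
     [((E1, E1), bv E2), ((E2, F2), bv F1)],
     [((E1, E1), bv E2), ((E3, F2), bv F1)],
     [((E1, E1), bv E2), ((E3, F2), bv F1), ((F1, F2), bv E2)],
     [((E1, E1), bv E2), ((E1, F2), bv F1)],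
     [((E1, E1), bv E2), ((E1, F2), bv F1), ((F1, F2), bv E2)],
     [((E1, E1), bv E2), ((E1, F2), bv F1), ((F1, F2), bv E3)],
     [((E1, E2), bv E3)],
     [((E1, E2), bv E3), ((F1, F2), bv E1)],
     [((E1, E2), bv E3), ((F1, F2), bv E3)],
     [((E1, E2), bv E3), ((F1, F2), bv E1 + bv E2)],
     [((E1, E2), bv E3), ((E3, F2), bv F1)],
     [((E1, E2), bv E3), ((E1, F2), bv F1)],
     [((E1, E2), bv E3), ((E1, F2), bv F1), ((F1, F2), bv E3)],
     [((E1, E2), bv E3), ((E1, F2), bv F1), ((E2, F2), bv F1)],
     [((E1, E2), bv E3), ((E1, F2), bv F1), ((E2, F2), bv F1), ((F1, F2), bv E3)],
     [((E1, E1), bv E2), ((E1, E2), bv E3)],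
     [((E1, E1), bv E2), ((E1, E2), bv E3), ((F1, F2), bv E2)],
     [((E1, E1), bv E2), ((E1, E2), bv E3), ((F1, F2), bv E3)],
     [((E1, E1), bv E2), ((E1, E2), bv E3), ((E2, F2), bv F1)],
     [((E1, E1), bv E2), ((E1, E2), bv E3), ((E1, F2), bv F1)],
     [((E1, E1), bv E2), ((E1, E2), bv E3), ((E1, F2), bv F1), ((F1, F2), bv E3)]]"

text \<open>The tables are numbered from 1 to 29, in the order of the list.\<close>

definition nilp_3_2 :: "nat \<Rightarrow> (complex ^ gen) superalg" where
  "nilp_3_2 n = table_superalg (tables_3_2 ! (n - 1))"

end

theory Submission
  imports Defs
begin

text \<open>Nilpotency is used in one form only: no nonzero vectors can be recovered, by linear
combinations, from products in which one of them is a factor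
(\<open>superalg_nilpotent_vanish\<close>). In particular a multiplication has no eigenvector with a
nonzero eigenvalue. For a nilpotent Jordan superalgebra of type (3,2) this leaves little freedom.

The even part has a basis with \<open>e1 e1 = a e2\<close>, \<open>e1 e2 = b e3\<close> and all other products 0, where
a and b are 0 or 1 (\<open>even_frame_exists\<close>). The odd part has a basis such that every even x kills
f1 and sends f2 to \<open>l(x) f1\<close>, so the action is a linear form l on the even part
(\<open>odd_frame_exists\<close>). As odd squares vanish, the product of odd elements is determined by the
single even vector \<open>c = f1 f2\<close>. Thus the superalgebra is the member \<open>nf a b l1 l2 l3 c1 c2 c3\<close> of an
explicit family (\<open>nf_iso_exists\<close>).

For such a member the Jordan superidentity and nilpotency become equations for l and c: with A the
even part, l vanishes on A A A, c annihilates A A, \<open>l(y) zc + l(z) yc = l(yz) c\<close> for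
all y, z in A, and \<open>l(c) = 0\<close> (\<open>nf_conditions_of_jordan\<close>). Replacing f1 and f2 by multiples rescales l and
c independently of each other, because complex square roots exist; the remaining freedom is a change
of the even basis (\<open>nf_iso_of_base_change\<close>). For each of the four pairs (a, b) the solutions fall into
finitely many orbits, 29 in total.

The listed algebras are told apart by eleven existential statements about products of homogeneous
elements. They are invariant under isomorphism, and their truth values differ for any two of the 29 tables (\<open>signature_iso\<close>, \<open>signature_nf\<close>).\<close>

section \<open>Isomorphisms of superalgebras\<close>

lemma superalg_iso_sym:
  assumes "superalg_iso A B"
  shows "superalg_iso B A"
proof -
  from assms obtain \<phi> where lin: "Vector_Spaces.linear (smul A) (smul B) \<phi>" and bij: "bij \<phi>"
    and hom: "\<And>x y. \<phi> (mul A x y) = mul B (\<phi> x) (\<phi> y)"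
    and ev: "\<phi> ` even_part A = even_part B" and od: "\<phi> ` odd_part A = odd_part B"
    unfolding superalg_iso_def by blast
  let ?g = "inv \<phi>"
  have gf: "?g (\<phi> x) = x" and fg: "\<phi> (?g y) = y" for x y
    using bij by (simp_all add: bij_is_inj bij_is_surj surj_f_inv_f)
  have "\<phi> (?g x + ?g y) = x + y" "\<phi> (smul A c (?g x)) = smul B c x"
    "\<phi> (mul A (?g x) (?g y)) = mul B x y" for x y c
    using lin[unfolded Vector_Spaces.linear_iff] by (simp_all add: fg hom)
  then have "?g (x + y) = ?g x + ?g y" "?g (smul B c x) = smul A c (?g x)"
    "?g (mul B x y) = mul A (?g x) (?g y)" for x y c
    by (metis gf)+
  moreover have "?g ` even_part B = even_part A" "?g ` odd_part B = odd_part A"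
    unfolding ev[symmetric] od[symmetric] by (simp_all add: image_image gf)
  moreover have "bij ?g" by (simp add: bij bij_imp_bij_inv)
  ultimately show ?thesis
    using lin unfolding superalg_iso_def Vector_Spaces.linear_iff by blast
qed

lemma superalg_iso_trans:
  assumes "superalg_iso A B" "superalg_iso B C"
  shows "superalg_iso A C"
proof -
  from assms(1) obtain \<phi> where 1: "Vector_Spaces.linear (smul A) (smul B) \<phi>" "bij \<phi>"
    "\<forall>x y. \<phi> (mul A x y) = mul B (\<phi> x) (\<phi> y)"
    "\<phi> ` even_part A = even_part B" "\<phi> ` odd_part A = odd_part B"
    unfolding superalg_iso_def by blast
  from assms(2) obtain \<psi> where 2: "Vector_Spaces.linear (smul B) (smul C) \<psi>" "bij \<psi>"
    "\<forall>x y. \<psi> (mul B x y) = mul C (\<psi> x) (\<psi> y)"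
    "\<psi> ` even_part B = even_part C" "\<psi> ` odd_part B = odd_part C"
    unfolding superalg_iso_def by blast
  have "Vector_Spaces.linear (smul A) (smul C) (\<psi> \<circ> \<phi>)"
    using 1(1) 2(1) by (simp add: Vector_Spaces.linear_iff)
  moreover have "bij (\<psi> \<circ> \<phi>)" using 1(2) 2(2) by (rule bij_comp)
  moreover have "\<forall>x y. (\<psi> \<circ> \<phi>) (mul A x y) = mul C ((\<psi> \<circ> \<phi>) x) ((\<psi> \<circ> \<phi>) y)"
    using 1(3) 2(3) by simp
  moreover have "(\<psi> \<circ> \<phi>) ` even_part A = even_part C" "(\<psi> \<circ> \<phi>) ` odd_part A = odd_part C"
    unfolding image_comp[symmetric] 1(4,5) 2(4,5) by simp_all
  ultimately show ?thesis unfolding superalg_iso_def by blast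
qed

section \<open>Subspaces of prescribed dimension\<close>

definition basis2 :: "('k::field \<Rightarrow> 'b::ab_group_add \<Rightarrow> 'b) \<Rightarrow> 'b set \<Rightarrow> 'b \<Rightarrow> 'b \<Rightarrow> bool" where
  "basis2 s S u v \<longleftrightarrow> u \<in> S \<and> v \<in> S
     \<and> (\<forall>a b. s a u + s b v = 0 \<longrightarrow> a = 0 \<and> b = 0)
     \<and> (\<forall>x\<in>S. \<exists>a b. x = s a u + s b v)"

definition basis3 :: "('k::field \<Rightarrow> 'b::ab_group_add \<Rightarrow> 'b) \<Rightarrow> 'b set \<Rightarrow> 'b \<Rightarrow> 'b \<Rightarrow> 'b \<Rightarrow> bool" where
  "basis3 s S u v w \<longleftrightarrow> u \<in> S \<and> v \<in> S \<and> w \<in> S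
     \<and> (\<forall>a b c. s a u + s b v + s c w = 0 \<longrightarrow> a = 0 \<and> b = 0 \<and> c = 0)
     \<and> (\<forall>x\<in>S. \<exists>a b c. x = s a u + s b v + s c w)"

context vector_space
begin

lemma solve_for:
  assumes "scale a u + v = 0" "a \<noteq> 0"
  shows "u = scale (- 1 / a) v"
proof -
  have "v = - scale a u" using assms(1) by (metis add.commute eq_neg_iff_add_eq_0)
  then show ?thesis using assms(2) by simp
qed

lemma exists_not_in_span:
  assumes "finite B" "card B < dim S"
  shows "\<exists>v\<in>S. v \<notin> span B"
  using assms dim_le_card[of S B] by auto

lemma spanning_of_card_eq_dim:
  assumes "independent B" "B \<subseteq> S" "card B = dim S" "dim S > 0"
  shows "S \<subseteq> span B"
proof (rule ccontr)
  assume "\<not> S \<subseteq> span B"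
  then obtain v where v: "v \<in> S" "v \<notin> span B" by auto
  have finB: "finite B" using assms card.infinite by force
  obtain C where C: "S \<subseteq> span C" "card C = dim S" using basis_exists by metis
  have "finite C" using C assms card.infinite by force
  moreover have "independent (insert v B)" using v assms by (simp add: independent_insertI)
  moreover have "insert v B \<subseteq> span C" using C v assms by auto
  ultimately have "card (insert v B) \<le> card C" using independent_span_bound by blast
  then show False using v finB C assms span_base[of v B] by (auto simp: card_insert_if split: if_splits)
qed

lemma in_span2: "x \<in> span {u, v} \<longleftrightarrow> (\<exists>a b. x = scale a u + scale b v)"
proof -
  have "x \<in> span {u, v} \<longleftrightarrow> (\<exists>a b. x - scale a u - scale b v = 0)"
    by (simp add: span_breakdown_eq)
  also have "\<dots> \<longleftrightarrow> (\<exists>a b. x = scale a u + scale b v)"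
    by (simp add: diff_diff_eq)
  finally show ?thesis .
qed

lemma in_span3: "x \<in> span {u, v, w} \<longleftrightarrow> (\<exists>a b c. x = scale a u + scale b v + scale c w)"
proof -
  have "x \<in> span {u, v, w} \<longleftrightarrow> (\<exists>a b c. x - scale a u - scale b v - scale c w = 0)"
    by (simp add: span_breakdown_eq)
  also have "\<dots> \<longleftrightarrow> (\<exists>a b c. x = scale a u + scale b v + scale c w)"
    by (simp add: diff_diff_eq add.assoc)
  finally show ?thesis .
qed

lemma basis2I:
  assumes "dim S = 2" "u \<in> S" "v \<in> S"
    and ind: "\<And>a b. scale a u + scale b v = 0 \<Longrightarrow> a = 0 \<and> b = 0"
  shows "basis2 scale S u v"
proof -
  have v: "v \<noteq> 0" using ind[of 0 1] by auto
  have u: "u \<notin> span {v}"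
  proof
    assume "u \<in> span {v}"
    then obtain k where "u = scale k v" by (auto simp: span_singleton)
    then show False using ind[of 1 "-k"] by simp
  qed
  have "u \<noteq> v" using u span_base[of v "{v}"] by auto
  moreover have "independent {u, v}" using u v by (simp add: independent_insert)
  ultimately have "S \<subseteq> span {u, v}" using assms by (intro spanning_of_card_eq_dim) auto
  then show ?thesis using assms unfolding basis2_def by (auto simp: in_span2[symmetric])
qed

lemma basis3I:
  assumes "dim S = 3" "u \<in> S" "v \<in> S" "w \<in> S"
    and ind: "\<And>a b c. scale a u + scale b v + scale c w = 0 \<Longrightarrow> a = 0 \<and> b = 0 \<and> c = 0"
  shows "basis3 scale S u v w"
proof -
  have w: "w \<noteq> 0" using ind[of 0 0 1] by auto
  have v: "v \<notin> span {w}"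
  proof
    assume "v \<in> span {w}"
    then obtain k where "v = scale k w" by (auto simp: span_singleton)
    then show False using ind[of 0 1 "-k"] by simp
  qed
  have u: "u \<notin> span {v, w}"
  proof
    assume "u \<in> span {v, w}"
    then obtain k l where "u = scale k v + scale l w" by (auto simp: in_span2)
    then show False using ind[of 1 "-k" "-l"] by simp
  qed
  have "u \<noteq> v" "u \<noteq> w" "v \<noteq> w"
    using u v span_base[of v "{v, w}"] span_base[of w "{v, w}"] span_base[of w "{w}"] by auto
  moreover have "independent {u, v, w}" using u v w by (simp add: independent_insert)
  ultimately have "S \<subseteq> span {u, v, w}" using assms by (intro spanning_of_card_eq_dim) auto
  then show ?thesis using assms unfolding basis3_def by (auto simp: in_span3[symmetric])
qed

lemma basis3_extend:
  assumes S: "dim S = 3" "u \<in> S" "v \<in> S"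
    and ind: "\<And>a b. scale a u + scale b v = 0 \<Longrightarrow> a = 0 \<and> b = 0"
  obtains w where "basis3 scale S u v w"
proof -
  have "card {u, v} < dim S" using S by (simp add: card_insert_if)
  then obtain w where w: "w \<in> S" "w \<notin> span {u, v}" using exists_not_in_span[of "{u, v}" S] by auto
  have "a = 0 \<and> b = 0 \<and> c = 0" if eq: "scale a u + scale b v + scale c w = 0" for a b c
  proof -
    have "c = 0"
    proof (rule ccontr)
      assume c: "c \<noteq> 0"
      have "scale c w = - (scale a u + scale b v)"
        using eq by (metis add.commute eq_neg_iff_add_eq_0)
      then have "scale (1 / c) (scale c w) = scale (1 / c) (- (scale a u + scale b v))" by simp
      then have "w = scale (- a / c) u + scale (- b / c) v"
        using c by (simp add: scale_right_distrib scale_right_diff_distrib)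
      then show False using w(2) unfolding in_span2 by blast
    qed
    then show ?thesis using eq ind[of a b] by simp
  qed
  then show ?thesis by (intro that[OF basis3I[OF S w(1)]])
qed

lemma basis3_exists:
  assumes S: "dim S = 3"
  obtains u v w where "basis3 scale S u v w"
proof -
  obtain u where u: "u \<in> S" "u \<notin> span {}" using exists_not_in_span[of "{}" S] S by auto
  obtain v where v: "v \<in> S" "v \<notin> span {u}" using exists_not_in_span[of "{u}" S] S by auto
  have ind: "a = 0 \<and> b = 0" if eq: "scale a u + scale b v = 0" for a b
  proof -
    have "b = 0"
    proof (rule ccontr)
      assume b: "b \<noteq> 0"
      have "scale b v = scale (- a) u" using eq by (simp add: eq_neg_iff_add_eq_0 add.commute)
      then have "scale (1 / b) (scale b v) = scale (1 / b) (scale (- a) u)" by simp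
      then have "v = scale (- a / b) u" using b by simp
      then show False using v unfolding span_singleton by blast
    qed
    then show ?thesis using eq u by simp
  qed
  show ?thesis
  proof (rule basis3_extend[OF S u(1) v(1)])
    show "a = 0 \<and> b = 0" if "scale a u + scale b v = 0" for a b using that by (rule ind)
  qed (rule that)
qed

lemma basis2_exists:
  assumes S: "dim S = 2"
  obtains u v where "basis2 scale S u v"
proof -
  obtain B where B: "B \<subseteq> S" "independent B" "card B = dim S" using basis_exists by metis
  then obtain u v where uv: "B = {u, v}" "u \<noteq> v" using S by (metis card_2_iff)
  have ind: "a = 0 \<and> b = 0" if "scale a u + scale b v = 0" for a b
  proof -
    let ?k = "\<lambda>x. if x = u then a else b"
    have "(\<Sum>x\<in>B. scale (?k x) x) = 0" using that uv by simp
    then have "?k x = 0" if "x \<in> B" for x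
      using independentD[OF B(2) _ subset_refl _ that, of ?k] uv(1) by simp
    from this[of u] this[of v] have "?k u = 0" "?k v = 0" using uv(1) by simp_all
    then show ?thesis using uv(2) by simp
  qed
  have "basis2 scale S u v" using S B uv ind by (intro basis2I) auto
  then show ?thesis by (rule that)
qed

end

section \<open>Nilpotency and products of homogeneous elements\<close>

context superalgebra
begin

lemma mul_add_right: "x \<star> (y + z) = x \<star> y + x \<star> z"
  and mul_smul_right: "x \<star> smul A k y = smul A k (x \<star> y)"
  using linear_mul_right[of x] by (simp_all add: Vector_Spaces.linear_iff)

lemma mul_add_left: "(x + y) \<star> z = x \<star> z + y \<star> z"
  and mul_smul_left: "smul A k x \<star> z = smul A k (x \<star> z)"
  using linear_mul_left[of z] by (simp_all add: Vector_Spaces.linear_iff)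

lemma mul_zero_right [simp]: "x \<star> 0 = 0"
  using mul_smul_right[of x 0 0] by simp

lemma mul_zero_left [simp]: "0 \<star> x = 0"
  using mul_smul_left[of 0 0 x] by simp

lemma mul_minus_right: "x \<star> (- y) = - (x \<star> y)"
  using mul_smul_right[of x "-1" y] by simp

lemma mul_minus_left: "(- x) \<star> y = - (x \<star> y)"
  using mul_smul_left[of "-1" x y] by simp

lemma mul_diff_right: "x \<star> (y - z) = x \<star> y - x \<star> z"
  using mul_add_right[of x y "- z"] by (simp add: mul_minus_right)

lemma mul_diff_left: "(x - y) \<star> z = x \<star> z - y \<star> z"
  using mul_add_left[of x "- y" z] by (simp add: mul_minus_left)

lemmas mul_expand = mul_add_right mul_smul_right mul_add_left mul_smul_left
  mul_minus_right mul_minus_left mul_diff_right mul_diff_left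

lemma even_mul_even: "x \<in> even_part A \<Longrightarrow> y \<in> even_part A \<Longrightarrow> x \<star> y \<in> even_part A"
  using graded[of 0 0 x y] by (simp add: hpart_def)

lemma even_mul_odd: "x \<in> even_part A \<Longrightarrow> y \<in> odd_part A \<Longrightarrow> x \<star> y \<in> odd_part A"
  using graded[of 0 1 x y] by (simp add: hpart_def)

lemma odd_mul_odd: "x \<in> odd_part A \<Longrightarrow> y \<in> odd_part A \<Longrightarrow> x \<star> y \<in> even_part A"
  using graded[of 1 1 x y] by (simp add: hpart_def)

lemmas even_intros = subspace_add[OF subspace_even] subspace_scale[OF subspace_even]
  subspace_diff[OF subspace_even] subspace_neg[OF subspace_even]

lemmas odd_intros = subspace_add[OF subspace_odd] subspace_scale[OF subspace_odd]
  subspace_diff[OF subspace_odd] subspace_neg[OF subspace_odd]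

text \<open>If every vector of X is a combination of products with a factor in X, then by induction X lies in
every power of the algebra, hence in 0.\<close>

lemma superalg_nilpotent_vanish:
  assumes nil: "superalg_nilpotent A"
    and X: "\<And>v. v \<in> X \<Longrightarrow> v \<in> span {x \<star> y | x y. x \<in> X \<or> y \<in> X}"
    and "v \<in> X"
  shows "v = 0"
proof -
  have "X \<subseteq> superalg_pow A (Suc n)" for n
  proof (induction n)
    case 0
    show ?case by simp
  next
    case (Suc n)
    let ?U = "\<Union>i\<in>{1..Suc n}. subspace_mul A (superalg_pow A i) (superalg_pow A (Suc (Suc n) - i))"
    have "x \<star> y \<in> ?U" if "x \<in> X \<or> y \<in> X" for x y
    proof (cases "x \<in> X")
      case True
      then have "x \<star> y \<in> subspace_mul A (superalg_pow A (Suc n)) (superalg_pow A (Suc (Suc n) - Suc n))"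
        using Suc unfolding subspace_mul_def by (intro span_base) auto
      then show ?thesis by (intro UN_I[of "Suc n"]) auto
    next
      case False
      then have "x \<star> y \<in> subspace_mul A (superalg_pow A 1) (superalg_pow A (Suc (Suc n) - 1))"
        using Suc that unfolding subspace_mul_def by (intro span_base) auto
      then show ?thesis by (intro UN_I[of 1]) auto
    qed
    then have "{x \<star> y | x y. x \<in> X \<or> y \<in> X} \<subseteq> ?U" by blast
    from span_mono[OF this] show ?case using X by auto
  qed
  moreover obtain k where "k \<ge> 1" "superalg_pow A k = {0}"
    using nil unfolding superalg_nilpotent_def by blast
  ultimately have "X \<subseteq> {0}" by (metis Suc_le_D One_nat_def)
  then show ?thesis using \<open>v \<in> X\<close> by blast
qed

lemma superalg_nilpotent_no_eigenvector:
  assumes nil: "superalg_nilpotent A" and eq: "x \<star> y = smul A k y" and "y \<noteq> 0"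
  shows "k = 0"
proof (rule ccontr)
  assume k: "k \<noteq> 0"
  have "y = 0"
  proof (rule superalg_nilpotent_vanish[OF nil, of "{y}"])
    fix v assume v: "v \<in> {y}"
    have "v = smul A (1 / k) (x \<star> y)" using k v by (simp add: eq)
    moreover have "smul A (1 / k) (x \<star> y) \<in> span {a \<star> b | a b. a \<in> {y} \<or> b \<in> {y}}"
      by (intro span_scale span_base) blast
    ultimately show "v \<in> span {a \<star> b | a b. a \<in> {y} \<or> b \<in> {y}}" by simp
  qed simp
  with \<open>y \<noteq> 0\<close> show False by simp
qed

end

context jordan_superalgebra
begin

lemma even_commute: "x \<in> even_part A \<Longrightarrow> y \<in> even_part A \<Longrightarrow> x \<star> y = y \<star> x"
  using supercommutative[of 0 0 x y] by (simp add: hpart_def)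

lemma odd_even_commute: "x \<in> even_part A \<Longrightarrow> y \<in> odd_part A \<Longrightarrow> y \<star> x = x \<star> y"
  using supercommutative[of 0 1 x y] by (simp add: hpart_def)

lemma odd_anticommute: "x \<in> odd_part A \<Longrightarrow> y \<in> odd_part A \<Longrightarrow> x \<star> y = - (y \<star> x)"
  using supercommutative[of 1 1 x y] by (simp add: hpart_def)

lemma odd_square: 
  assumes "x \<in> odd_part A"
  shows "x \<star> x = 0"
proof -
  have "x \<star> x + x \<star> x = 0" using odd_anticommute[OF assms assms] by (simp add: eq_neg_iff_add_eq_0)
  then have "smul A 2 (x \<star> x) = 0" using scale_left_distrib[of 1 1 "x \<star> x"] by simp
  then show ?thesis by simp
qed

lemma even_jordan_identity:
  assumes "w \<in> even_part A" "x \<in> even_part A" "y \<in> even_part A" "z \<in> even_part A"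
  shows "(w \<star> x) \<star> (y \<star> z) + (w \<star> y) \<star> (x \<star> z) + (w \<star> z) \<star> (x \<star> y)
    = x \<star> (w \<star> (y \<star> z)) + y \<star> (w \<star> (x \<star> z)) + z \<star> (w \<star> (x \<star> y))"
  using jordan_superidentity[of 0 0 0 0 w x y z] assms
  by (simp add: hpart_def algebra_simps)

end

section \<open>Normal form of the even part\<close>

context jordan_superalgebra
begin

text \<open>The commutative algebras of dimension 3 that the even part can be: up to isomorphism they are
given by a and b in {0, 1}.\<close>

definition even_frame :: "complex \<Rightarrow> complex \<Rightarrow> 'a \<Rightarrow> 'a \<Rightarrow> 'a \<Rightarrow> bool" where
  "even_frame a b e1 e2 e3 \<longleftrightarrow> basis3 (smul A) (even_part A) e1 e2 e3
     \<and> e1 \<star> e1 = smul A a e2 \<and> e1 \<star> e2 = smul A b e3 \<and> e1 \<star> e3 = 0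
     \<and> e2 \<star> e2 = 0 \<and> e2 \<star> e3 = 0 \<and> e3 \<star> e3 = 0"

text \<open>The powers x, xx, x(xx) are independent and multiplication by x is nilpotent, so it kills the third
of them. This does not determine the products that do not involve x: nilpotency alone would allow
\<open>(xx)(xx) \<noteq> 0\<close>. The Jordan identity expresses them through multiplications by x and shows that they vanish.\<close>

lemma even_frame_cube_nonzero:
  assumes nil: "superalg_nilpotent A" and dim: "dim (even_part A) = 3"
    and x: "x \<in> even_part A" and cube: "x \<star> (x \<star> x) \<noteq> 0"
  shows "even_frame 1 1 x (x \<star> x) (x \<star> (x \<star> x))"
proof -
  define y where "y = x \<star> x"
  define z where "z = x \<star> y"
  note vanish = superalg_nilpotent_vanish[OF nil]
  have y: "y \<in> even_part A" and z: "z \<in> even_part A"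
    using x by (simp_all add: y_def z_def even_mul_even)
  have nz: "x \<noteq> 0" "y \<noteq> 0" "z \<noteq> 0" using cube by (auto simp: y_def z_def)
  have basis: "basis3 (smul A) (even_part A) x y z"
  proof (rule basis3I[OF dim x y z])
    fix a b c assume eq: "smul A a x + smul A b y + smul A c z = 0"
    have a: "a = 0"
    proof (rule ccontr)
      assume "a \<noteq> 0"
      then have xeq: "x = smul A (- 1 / a) (smul A b (x \<star> x) + smul A c (x \<star> y))"
        using solve_for[of a x] eq by (simp add: add.assoc y_def z_def)
      moreover have "smul A (- 1 / a) (smul A b (x \<star> x) + smul A c (x \<star> y))
          \<in> span {p \<star> q | p q. p \<in> {x} \<or> q \<in> {x}}"
        by (intro span_scale span_add span_base) blast+
      ultimately show False using vanish[of "{x}" x] nz by simp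
    qed
    have b: "b = 0"
    proof (rule ccontr)
      assume "b \<noteq> 0"
      then have "y = smul A (- 1 / b) (smul A c (x \<star> y))"
        using eq a by (intro solve_for) (simp_all add: z_def)
      moreover have "smul A (- 1 / b) (smul A c (x \<star> y)) \<in> span {p \<star> q | p q. p \<in> {y} \<or> q \<in> {y}}"
        by (intro span_scale span_base) blast
      ultimately show False using vanish[of "{y}" y] nz by simp
    qed
    show "a = 0 \<and> b = 0 \<and> c = 0" using eq a b nz by simp
  qed
  have xz: "x \<star> z = 0"
  proof -
    have "x \<star> z \<in> even_part A" using x z by (rule even_mul_even)
    then obtain p q r where eq: "x \<star> z = smul A p x + smul A q y + smul A r z"
      using basis unfolding basis3_def by metis
    have p: "p = 0"
    proof (rule ccontr)
      assume "p \<noteq> 0"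
      then have "x = smul A (1 / p) (x \<star> z - smul A q (x \<star> x) - smul A r (x \<star> y))"
        unfolding eq by (simp add: y_def z_def)
      moreover have "smul A (1 / p) (x \<star> z - smul A q (x \<star> x) - smul A r (x \<star> y))
          \<in> span {s \<star> t | s t. s \<in> {x} \<or> t \<in> {x}}"
        by (intro span_scale span_diff span_base) blast+
      ultimately show False using vanish[of "{x}" x] nz by simp
    qed
    have q: "q = 0"
    proof (rule ccontr)
      assume "q \<noteq> 0"
      then have "y = smul A (1 / q) (x \<star> z - smul A r (x \<star> y))"
        unfolding eq by (simp add: p z_def)
      moreover have "smul A (1 / q) (x \<star> z - smul A r (x \<star> y))
          \<in> span {s \<star> t | s t. s \<in> {y, z} \<or> t \<in> {y, z}}"
        by (intro span_scale span_diff span_base) blast+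
      moreover have "z \<in> span {s \<star> t | s t. s \<in> {y, z} \<or> t \<in> {y, z}}"
        unfolding z_def by (intro span_base) blast
      ultimately show False using vanish[of "{y, z}" y] nz by auto
    qed
    have "r = 0" using superalg_nilpotent_no_eigenvector[OF nil _ nz(3), of x r] eq p q by simp
    then show ?thesis using eq p q by simp
  qed
  have yy: "y \<star> y = 0"
  proof -
    have "smul A 3 (y \<star> y) = 0"
      using even_jordan_identity[OF x x x x] xz scale_left_distrib[of 1 2 "y \<star> y"]
        scale_left_distrib[of 1 1 "y \<star> y"]
      by (simp add: y_def[symmetric] z_def[symmetric] add.assoc)
    then show ?thesis by simp
  qed
  have yz: "y \<star> z = 0"
  proof -
    have "smul A 3 (y \<star> z) = y \<star> z"
      using even_jordan_identity[OF x x x y] xz even_commute[OF z y]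
        scale_left_distrib[of 1 2 "y \<star> z"] scale_left_distrib[of 1 1 "y \<star> z"]
      by (simp add: y_def[symmetric] z_def[symmetric] add.assoc)
    then have "smul A 2 (y \<star> z) = 0"
      using scale_left_distrib[of 2 1 "y \<star> z"] by simp
    then show ?thesis by simp
  qed
  have zz: "z \<star> z = 0"
  proof -
    have "smul A 2 (z \<star> z) = 0"
      using even_jordan_identity[OF x y x y] xz yy yz even_commute[OF x y]
        scale_left_distrib[of 1 1 "z \<star> z"]
      by (simp add: y_def[symmetric] z_def[symmetric])
    then show ?thesis by simp
  qed
  show ?thesis
    unfolding even_frame_def using basis xz yy yz zz by (simp add: y_def z_def)
qed

text \<open>With all cubes zero, \<open>y = xx\<close> is independent of x, and a suitable third basis vector v is
annihilated by x and y, and vv is a multiple of y. The products are then those of a quadratic form,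
whose rank 1 or 2 on the span of x and v decides between the two tables.\<close>

lemma even_frame_cube_zero:
  assumes nil: "superalg_nilpotent A" and dim: "dim (even_part A) = 3"
    and cube: "\<And>x. x \<in> even_part A \<Longrightarrow> x \<star> (x \<star> x) = 0"
    and x: "x \<in> even_part A" and square: "x \<star> x \<noteq> 0"
  shows "\<exists>e1 e2 e3. even_frame 1 0 e1 e2 e3 \<or> even_frame 0 1 e1 e2 e3"
proof -
  define y where "y = x \<star> x"
  have y: "y \<in> even_part A" using x by (simp add: y_def even_mul_even)
  have nz: "x \<noteq> 0" "y \<noteq> 0" using square by (auto simp: y_def)
  have xy: "x \<star> y = 0" using cube[OF x] by (simp add: y_def)
  have ind: "a = 0 \<and> b = 0" if eq: "smul A a x + smul A b y = 0" for a b
  proof -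
    have "x \<star> (smul A a x + smul A b y) = 0" by (simp add: eq)
    then have "a = 0" using nz by (simp add: mul_expand xy y_def[symmetric])
    then show ?thesis using eq nz by simp
  qed
  have yy: "y \<star> y = 0"
  proof -
    have "smul A 3 (y \<star> y) = 0"
      using even_jordan_identity[OF x x x x] xy scale_left_distrib[of 1 2 "y \<star> y"]
        scale_left_distrib[of 1 1 "y \<star> y"] by (simp add: y_def[symmetric] add.assoc)
    then show ?thesis by simp
  qed
  \<comment> \<open>The part of \<open>(u + v)((u + v)(u + v)) = 0\<close> that is linear in v.\<close>
  have polar: "smul A 2 (u \<star> (u \<star> v)) + v \<star> (u \<star> u) = 0"
    if uv: "u \<in> even_part A" "v \<in> even_part A" for u v
  proof -
    define s where "s = u \<star> (v \<star> v) + v \<star> (u \<star> v) + v \<star> (u \<star> v)"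
    define t where "t = u \<star> (u \<star> v) + u \<star> (u \<star> v) + v \<star> (u \<star> u)"
    have vu: "v \<star> u = u \<star> v" using uv by (simp add: even_commute)
    have "s + t = (u + v) \<star> ((u + v) \<star> (u + v)) - u \<star> (u \<star> u) - v \<star> (v \<star> v)"
      "s - t = (u - v) \<star> ((u - v) \<star> (u - v)) - u \<star> (u \<star> u) + v \<star> (v \<star> v)"
      by (simp_all add: s_def t_def mul_expand vu algebra_simps)
    then have "s + t = 0" "s = t"
      using uv by (simp_all add: cube even_intros)
    then have "smul A 2 t = 0" using scale_left_distrib[of 1 1 t] by simp
    then show ?thesis using scale_left_distrib[of 1 1 "u \<star> (u \<star> v)"] by (simp add: t_def)
  qed
  obtain w where w: "basis3 (smul A) (even_part A) x y w"
    using basis3_extend[OF dim x y ind] by metis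
  have "x \<star> w \<in> even_part A" using x w by (simp add: basis3_def even_mul_even)
  then obtain p q r where xw: "x \<star> w = smul A p x + smul A q y + smul A r w"
    using w unfolding basis3_def by metis
  \<comment> \<open>Subtracting \<open>q x\<close> cancels the y-component of xw, as \<open>x x = y\<close>.\<close>
  define v where "v = w - smul A q x"
  have v: "v \<in> even_part A" using w x by (simp add: v_def basis3_def even_intros)
  have basis: "basis3 (smul A) (even_part A) x y v"
  proof (rule basis3I[OF dim x y v])
    fix a b c assume "smul A a x + smul A b y + smul A c v = 0"
    then have "smul A (a - c * q) x + smul A b y + smul A c w = 0"
      by (simp add: v_def scale_right_diff_distrib scale_left_diff_distrib algebra_simps)
    then have "a - c * q = 0 \<and> b = 0 \<and> c = 0" using w unfolding basis3_def by blast
    then show "a = 0 \<and> b = 0 \<and> c = 0" by simp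
  qed
  have r: "r = 0"
  proof (rule ccontr)
    assume r: "r \<noteq> 0"
    \<comment> \<open>The eigenvector for r of the triangular matrix by which x acts on x, y, w.\<close>
    define u where "u = smul A (p / r) x + smul A ((q + p / r) / r) y + w"
    have "x \<star> u = smul A r u"
      using r by (simp add: u_def mul_expand xy xw y_def[symmetric] scale_right_distrib
          scale_left_distrib add_divide_distrib algebra_simps)
    moreover have "u \<noteq> 0"
    proof
      assume "u = 0"
      then have "smul A (p / r) x + smul A ((q + p / r) / r) y + smul A 1 w = 0" by (simp add: u_def)
      then show False using w unfolding basis3_def by (metis one_neq_zero)
    qed
    ultimately show False using superalg_nilpotent_no_eigenvector[OF nil] r by blast
  qed
  have "x \<star> v = smul A p x" by (simp add: v_def mul_expand xw r y_def[symmetric])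
  then have "p = 0"
    using superalg_nilpotent_no_eigenvector[OF nil _ nz(1), of v p] even_commute[OF x v] by simp
  then have xv: "x \<star> v = 0" using \<open>x \<star> v = smul A p x\<close> by simp
  have yv: "y \<star> v = 0"
    using polar[OF x v] by (simp add: xv y_def[symmetric] even_commute[OF y v])
  have "v \<star> v \<in> even_part A" using v by (simp add: even_mul_even)
  then obtain a b c where vv: "v \<star> v = smul A a x + smul A b y + smul A c v"
    using basis unfolding basis3_def by metis
  have "x \<star> (v \<star> v) = 0" using polar[OF v x] xv by (simp add: even_commute[OF v x])
  then have a: "a = 0" using nz by (simp add: vv mul_expand xy xv y_def[symmetric])
  have "v \<star> (v \<star> v) = smul A c (v \<star> v)"
    using a by (subst vv) (simp add: mul_expand even_commute[OF v y] yv)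
  then have "c = 0 \<or> v \<star> v = 0" using cube[OF v] by simp
  moreover have "c = 0" if "v \<star> v = 0"
  proof -
    have "smul A 0 x + smul A b y + smul A c v = 0" using that vv a by simp
    then show ?thesis using basis unfolding basis3_def by blast
  qed
  ultimately have vv': "v \<star> v = smul A b y" using vv a by auto
  show ?thesis
  proof (cases "b = 0")
    case True
    have "even_frame 1 0 x y v"
      unfolding even_frame_def using basis vv' True xv yv xy yy by (simp add: y_def)
    then show ?thesis by blast
  next
    case False
    \<comment> \<open>With \<open>t t = - y\<close> the vectors \<open>x + t\<close> and \<open>x - t\<close> have square 0 and product \<open>2 y\<close>.\<close>
    define k where "k = csqrt (- 1 / b)"
    have k: "k * k * b = -1" "k \<noteq> 0"
      using False power2_csqrt[of "- 1 / b"] by (auto simp: k_def power2_eq_square[symmetric])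
    define t where "t = smul A k v"
    have tt: "t \<star> t = - y" and xt: "x \<star> t = 0" and tx: "t \<star> x = 0" and yt: "y \<star> t = 0"
      and ty: "t \<star> y = 0" and t: "t \<in> even_part A"
      using k v by (simp_all add: t_def mul_expand vv' xv yv even_commute[OF v x] even_commute[OF v y] 
        even_intros mult.assoc)
    have xx: "x \<star> x = y" by (simp add: y_def)
    have yx: "y \<star> x = 0" using xy even_commute[OF x y] by simp
    have "basis3 (smul A) (even_part A) (x + t) (x - t) (smul A 2 y)"
    proof (rule basis3I[OF dim])
      show "x + t \<in> even_part A" "x - t \<in> even_part A" "smul A 2 y \<in> even_part A"
        using x y t by (simp_all add: even_intros)
      fix f g h assume "smul A f (x + t) + smul A g (x - t) + smul A h (smul A 2 y) = 0"
      then have "smul A (f + g) x + smul A (2 * h) y + smul A (k * (f - g)) v = 0"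
        by (simp add: t_def scale_right_diff_distrib scale_left_diff_distrib scale_right_distrib
            scale_left_distrib algebra_simps)
      then have "f + g = 0 \<and> 2 * h = 0 \<and> k * (f - g) = 0" using basis unfolding basis3_def by blast
      then have "h = 0" "f = g" "2 * g = 0" using k by (simp_all, simp)
      then show "f = 0 \<and> g = 0 \<and> h = 0" by simp
    qed
    then have "even_frame 0 1 (x + t) (x - t) (smul A 2 y)"
      using scale_left_distrib[of 1 1 y]
      by (simp add: even_frame_def mul_expand xx tt xt tx xy yx yt ty yy)
    then show ?thesis by blast
  qed
qed

lemma even_frame_square_zero:
  assumes dim: "dim (even_part A) = 3"
    and square: "\<And>x. x \<in> even_part A \<Longrightarrow> x \<star> x = 0"
  shows "\<exists>e1 e2 e3. even_frame 0 0 e1 e2 e3"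
proof -
  have "x \<star> y = 0" if "x \<in> even_part A" "y \<in> even_part A" for x y
  proof -
    have "(x + y) \<star> (x + y) = 0" using that by (simp add: square even_intros)
    then have "smul A 2 (x \<star> y) = 0"
      using that scale_left_distrib[of 1 1 "x \<star> y"]
      by (simp add: mul_expand square even_commute[of y x])
    then show ?thesis by simp
  qed
  moreover obtain u v w where "basis3 (smul A) (even_part A) u v w" using basis3_exists[OF dim] .
  ultimately show ?thesis unfolding even_frame_def basis3_def by (metis scale_zero_left)
qed

lemma even_frame_exists:
  assumes "superalg_nilpotent A" "dim (even_part A) = 3"
  obtains a b e1 e2 e3 where "a \<in> {0, 1}" "b \<in> {0, 1}" "even_frame a b e1 e2 e3"
  using even_frame_cube_nonzero[OF assms] even_frame_cube_zero[OF assms]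
    even_frame_square_zero[OF assms(2)] by (metis insertI1 insertI2)

end

section \<open>Normal form of the odd part\<close>

context jordan_superalgebra
begin

text \<open>If some even x0 does not kill the odd part, then f1 is taken to be \<open>x0 f2\<close>, for any f2 not killed by
x0. Were f2 to occur in \<open>x f1\<close> or \<open>x f2\<close> for an even x, it could be recovered from products of f1 and
f2 with x and x0, against nilpotency.\<close>

lemma odd_frame_exists:
  assumes nil: "superalg_nilpotent A" and dim: "dim (odd_part A) = 2"
  obtains f1 f2 where "basis2 (smul A) (odd_part A) f1 f2"
    and "\<And>x. x \<in> even_part A \<Longrightarrow> x \<star> f1 = 0"
    and "\<And>x. x \<in> even_part A \<Longrightarrow> \<exists>k. x \<star> f2 = smul A k f1"
proof (cases "\<forall>x\<in>even_part A. \<forall>f\<in>odd_part A. x \<star> f = 0")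
  case True
  obtain f1 f2 where b: "basis2 (smul A) (odd_part A) f1 f2" using basis2_exists[OF dim] .
  then have "x \<star> f1 = 0" "x \<star> f2 = smul A 0 f1" if "x \<in> even_part A" for x
    using True that by (simp_all add: basis2_def)
  with b that show ?thesis by blast
next
  case False
  note vanish = superalg_nilpotent_vanish[OF nil]
  obtain x0 f2 where x0: "x0 \<in> even_part A" and f2: "f2 \<in> odd_part A" and nz: "x0 \<star> f2 \<noteq> 0"
    using False by blast
  define f1 where "f1 = x0 \<star> f2"
  have f1: "f1 \<in> odd_part A" using x0 f2 by (simp add: f1_def even_mul_odd)
  have nz: "f1 \<noteq> 0" "f2 \<noteq> 0" using nz by (auto simp: f1_def)
  have basis: "basis2 (smul A) (odd_part A) f1 f2"
  proof (rule basis2I[OF dim f1 f2])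
    fix a b assume eq: "smul A a f1 + smul A b f2 = 0"
    have "a = 0"
    proof (rule ccontr)
      assume a: "a \<noteq> 0"
      have "x0 \<star> f2 = smul A (- 1 / a) (smul A b f2)"
        using solve_for[OF eq a] by (simp add: f1_def)
      then have "x0 \<star> f2 = smul A (- b / a) f2" by simp
      from superalg_nilpotent_no_eigenvector[OF nil this nz(2)] show False
        using a eq nz by simp
    qed
    then show "a = 0 \<and> b = 0" using eq nz by simp
  qed
  have f1_zero: "x \<star> f1 = 0" if x: "x \<in> even_part A" for x
  proof -
    obtain a b where eq: "x \<star> f1 = smul A a f1 + smul A b f2"
      using basis even_mul_odd[OF x f1] unfolding basis2_def by metis
    have b: "b = 0"
    proof (rule ccontr)
      assume "b \<noteq> 0"
      then have "f2 = smul A (1 / b) (x \<star> f1 - smul A a (x0 \<star> f2))"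
        unfolding eq by (simp add: f1_def)
      moreover have "smul A (1 / b) (x \<star> f1 - smul A a (x0 \<star> f2))
          \<in> span {s \<star> t | s t. s \<in> {f1, f2} \<or> t \<in> {f1, f2}}"
        by (intro span_scale span_diff span_base) blast+
      moreover have "f1 \<in> span {s \<star> t | s t. s \<in> {f1, f2} \<or> t \<in> {f1, f2}}"
        unfolding f1_def by (intro span_base) blast
      ultimately show False using vanish[of "{f1, f2}" f2] nz by auto
    qed
    then have "a = 0" using superalg_nilpotent_no_eigenvector[OF nil _ nz(1), of x a] eq by simp
    then show ?thesis using eq b by simp
  qed
  have "\<exists>k. x \<star> f2 = smul A k f1" if x: "x \<in> even_part A" for x
  proof -
    obtain a b where eq: "x \<star> f2 = smul A a f1 + smul A b f2"
      using basis even_mul_odd[OF x f2] unfolding basis2_def by metis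
    have "b = 0"
    proof (rule ccontr)
      assume "b \<noteq> 0"
      then have "f2 = smul A (1 / b) (x \<star> f2 - smul A a (x0 \<star> f2))"
        unfolding eq by (simp add: f1_def)
      moreover have "smul A (1 / b) (x \<star> f2 - smul A a (x0 \<star> f2))
          \<in> span {s \<star> t | s t. s \<in> {f2} \<or> t \<in> {f2}}"
        by (intro span_scale span_diff span_base) blast+
      ultimately show False using vanish[of "{f2}" f2] nz by auto
    qed
    then show ?thesis using eq by auto
  qed
  with basis f1_zero that show ?thesis by blast
qed

end

section \<open>A parametrised family of multiplication tables\<close>

text \<open>The numbers l1, l2, l3 are the values of the linear form l on the even basis, and c1, c2, c3 are the
coordinates of \<open>f1 f2\<close>.\<close>

definition nf_table :: "complex \<Rightarrow> complex \<Rightarrow> complex \<Rightarrow> complex \<Rightarrow> complex \<Rightarrow> complex \<Rightarrow> complex \<Rightarrow> complex \<Rightarrow> mul_table"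
  where "nf_table a b l1 l2 l3 c1 c2 c3 =
    [((E1, E1), a *s bv E2), ((E1, E2), b *s bv E3),
     ((E1, F2), l1 *s bv F1), ((E2, F2), l2 *s bv F1), ((E3, F2), l3 *s bv F1),
     ((F1, F2), c1 *s bv E1 + c2 *s bv E2 + c3 *s bv E3)]"

definition nf :: "complex \<Rightarrow> complex \<Rightarrow> complex \<Rightarrow> complex \<Rightarrow> complex \<Rightarrow> complex \<Rightarrow> complex \<Rightarrow> complex
    \<Rightarrow> (complex ^ gen) superalg"
  where "nf a b l1 l2 l3 c1 c2 c3 = table_superalg (nf_table a b l1 l2 l3 c1 c2 c3)"

lemma all_gen: "(\<forall>g. P g) \<longleftrightarrow> P E1 \<and> P E2 \<and> P E3 \<and> P F1 \<and> P F2"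
  by (metis gen.exhaust)

lemma vec_gen_eq_iff:
  fixes x y :: "complex ^ gen"
  shows "x = y \<longleftrightarrow> x $ E1 = y $ E1 \<and> x $ E2 = y $ E2 \<and> x $ E3 = y $ E3 \<and> x $ F1 = y $ F1 \<and> x $ F2 = y $ F2"
  by (simp add: vec_eq_iff all_gen)

lemma smul_nf [simp]: "smul (nf a b l1 l2 l3 c1 c2 c3) = (*s)"
  by (simp add: nf_def table_superalg_def)

lemma even_part_nf: "x \<in> even_part (nf a b l1 l2 l3 c1 c2 c3) \<longleftrightarrow> x $ F1 = 0 \<and> x $ F2 = 0"
  by (auto simp: nf_def table_superalg_def all_gen odd_gen_def)

lemma odd_part_nf: "x \<in> odd_part (nf a b l1 l2 l3 c1 c2 c3) \<longleftrightarrow> x $ E1 = 0 \<and> x $ E2 = 0 \<and> x $ E3 = 0"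
  by (auto simp: nf_def table_superalg_def all_gen odd_gen_def)

lemma mul_nf:
  fixes a b l1 l2 l3 c1 c2 c3 :: complex and x y
  defines "m \<equiv> mul (nf a b l1 l2 l3 c1 c2 c3) x y"
  shows "m $ E1 = c1 * (x $ F1 * y $ F2 - x $ F2 * y $ F1)"
    and "m $ E2 = a * (x $ E1 * y $ E1) + c2 * (x $ F1 * y $ F2 - x $ F2 * y $ F1)"
    and "m $ E3 = b * (x $ E1 * y $ E2 + x $ E2 * y $ E1) + c3 * (x $ F1 * y $ F2 - x $ F2 * y $ F1)"
    and "m $ F1 = (l1 * x $ E1 + l2 * x $ E2 + l3 * x $ E3) * y $ F2
      + (l1 * y $ E1 + l2 * y $ E2 + l3 * y $ E3) * x $ F2"
    and "m $ F2 = 0"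
  unfolding m_def
  by (simp_all add: nf_def table_superalg_def UNIV_gen gen_mul_def nf_table_def odd_gen_def axis_def)
    (simp_all add: algebra_simps)

lemma table_superalg_cong:
  assumes "\<And>g h. gen_mul S g h = gen_mul T g h"
  shows "table_superalg S = table_superalg T"
  by (simp add: table_superalg_def assms)

lemma nilp_3_2_eq_nf:
  "nilp_3_2 1 = nf 0 0 0 0 0 0 0 0"
  "nilp_3_2 2 = nf 0 0 0 0 0 0 1 0"
  "nilp_3_2 3 = nf 0 0 1 0 0 0 0 0"
  "nilp_3_2 4 = nf 0 0 1 0 0 0 1 0"
  "nilp_3_2 5 = nf 1 0 0 0 0 0 0 0"
  "nilp_3_2 6 = nf 1 0 0 0 0 1 0 0"
  "nilp_3_2 7 = nf 1 0 0 0 0 0 1 0"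
  "nilp_3_2 8 = nf 1 0 0 0 0 0 0 1"
  "nilp_3_2 9 = nf 1 0 0 1 0 0 0 0"
  "nilp_3_2 10 = nf 1 0 0 0 1 0 0 0"
  "nilp_3_2 11 = nf 1 0 0 0 1 0 1 0"
  "nilp_3_2 12 = nf 1 0 1 0 0 0 0 0"
  "nilp_3_2 13 = nf 1 0 1 0 0 0 1 0"
  "nilp_3_2 14 = nf 1 0 1 0 0 0 0 1"
  "nilp_3_2 15 = nf 0 1 0 0 0 0 0 0"
  "nilp_3_2 16 = nf 0 1 0 0 0 1 0 0"
  "nilp_3_2 17 = nf 0 1 0 0 0 0 0 1"
  "nilp_3_2 18 = nf 0 1 0 0 0 1 1 0"
  "nilp_3_2 19 = nf 0 1 0 0 1 0 0 0"
  "nilp_3_2 20 = nf 0 1 1 0 0 0 0 0"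
  "nilp_3_2 21 = nf 0 1 1 0 0 0 0 1"
  "nilp_3_2 22 = nf 0 1 1 1 0 0 0 0"
  "nilp_3_2 23 = nf 0 1 1 1 0 0 0 1"
  "nilp_3_2 24 = nf 1 1 0 0 0 0 0 0"
  "nilp_3_2 25 = nf 1 1 0 0 0 0 1 0"
  "nilp_3_2 26 = nf 1 1 0 0 0 0 0 1"
  "nilp_3_2 27 = nf 1 1 0 1 0 0 0 0"
  "nilp_3_2 28 = nf 1 1 1 0 0 0 0 0"
  "nilp_3_2 29 = nf 1 1 1 0 0 0 0 1"
  unfolding nilp_3_2_def nf_def
  by (rule table_superalg_cong; rename_tac g h; case_tac g; case_tac h;
      simp add: tables_3_2_def gen_mul_def nf_table_def odd_gen_def)+

section \<open>The twenty-nine tables define nilpotent Jordan superalgebras\<close>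

definition jordan_defect ::
  "'a::ab_group_add superalg \<Rightarrow> nat \<Rightarrow> nat \<Rightarrow> nat \<Rightarrow> nat \<Rightarrow> 'a \<Rightarrow> 'a \<Rightarrow> 'a \<Rightarrow> 'a \<Rightarrow> 'a"
  where
  "jordan_defect A p q r s w x y z = mul A (mul A w x) (mul A y z)
      + smul A ((-1) ^ (q * r)) (mul A (mul A w y) (mul A x z))
      + smul A ((-1) ^ ((q + r) * s)) (mul A (mul A w z) (mul A x y))
      - smul A ((-1) ^ (p * q)) (mul A x (mul A w (mul A y z)))
      - smul A ((-1) ^ (r * (p + q))) (mul A y (mul A w (mul A x z)))
      - smul A ((-1) ^ (s * (p + q + r))) (mul A z (mul A w (mul A x y)))"

lemma superalgebra_nf: "superalgebra (nf a b l1 l2 l3 c1 c2 c3)"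
proof -
  let ?A = "nf a b l1 l2 l3 c1 c2 c3"
  have "\<exists>u\<in>even_part ?A. \<exists>v\<in>odd_part ?A. x = u + v" for x
    by (rule bexI[of _ "\<chi> g. if odd_gen g then 0 else x $ g"],
        rule bexI[of _ "\<chi> g. if odd_gen g then x $ g else 0"])
      (simp_all add: even_part_nf odd_part_nf vec_gen_eq_iff odd_gen_def)
  moreover have "even_part ?A \<inter> odd_part ?A = {0}"
    by (auto simp: even_part_nf odd_part_nf vec_gen_eq_iff)
  moreover have "mul ?A x y \<in> hpart ?A (i + j)"
    if "i \<in> {0, 1}" "j \<in> {0, 1}" "x \<in> hpart ?A i" "y \<in> hpart ?A j" for i j x y
    using that by (elim insertE emptyE) (simp_all add: hpart_def even_part_nf odd_part_nf mul_nf)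
  ultimately show ?thesis
    by (intro superalgebra.intro superalgebra_axioms.intro)
      (simp_all add: vec.vector_space_axioms vec.subspace_def even_part_nf odd_part_nf
        Vector_Spaces.linear_iff vec_gen_eq_iff mul_nf algebra_simps)
qed


lemma supercommutative_nf:
  assumes "q \<in> {0, 1}" "r \<in> {0, 1}"
    and "x \<in> hpart (nf a b l1 l2 l3 c1 c2 c3) q" "y \<in> hpart (nf a b l1 l2 l3 c1 c2 c3) r"
  shows "mul (nf a b l1 l2 l3 c1 c2 c3) x y
    = (-1) ^ (q * r) *s mul (nf a b l1 l2 l3 c1 c2 c3) y x"
  using assms
  by (elim insertE emptyE)
    (simp_all add: hpart_def even_part_nf odd_part_nf mul_nf vec_gen_eq_iff,
      simp_all add: algebra_simps)


lemma jordan_superalgebra_nfI: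
  assumes "\<And>p q r s w x y z. p \<in> {0, 1} \<Longrightarrow> q \<in> {0, 1} \<Longrightarrow> r \<in> {0, 1} \<Longrightarrow> s \<in> {0, 1} \<Longrightarrow>
    w \<in> hpart (nf a b l1 l2 l3 c1 c2 c3) p \<Longrightarrow> x \<in> hpart (nf a b l1 l2 l3 c1 c2 c3) q \<Longrightarrow>
    y \<in> hpart (nf a b l1 l2 l3 c1 c2 c3) r \<Longrightarrow> z \<in> hpart (nf a b l1 l2 l3 c1 c2 c3) s \<Longrightarrow>
    jordan_defect (nf a b l1 l2 l3 c1 c2 c3) p q r s w x y z = 0"
  shows "jordan_superalgebra (nf a b l1 l2 l3 c1 c2 c3)"
proof (intro jordan_superalgebra.intro jordan_superalgebra_axioms.intro superalgebra_nf, goal_cases)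
  case (1 q r x y)
  then show ?case unfolding smul_nf by (rule supercommutative_nf)
next
  case (2 p q r s w x y z)
  then show ?case using assms unfolding jordan_defect_def by presburger
qed

text \<open>In each family the zero parameters make every term of the equations for l and c vanish, whatever
the values of the others; together the families cover all 29 tables.\<close>

lemma jordan_superalgebra_nf:
  "jordan_superalgebra (nf a b 0 0 0 0 c2 c3)"
  "jordan_superalgebra (nf a 0 0 0 0 c1 c2 c3)"
  "jordan_superalgebra (nf 0 b 0 0 0 c1 c2 c3)"
  "jordan_superalgebra (nf a b l1 l2 0 0 0 0)"
  "jordan_superalgebra (nf 0 b l1 l2 l3 0 0 0)"
  "jordan_superalgebra (nf a b l1 0 0 0 0 c3)"
  "jordan_superalgebra (nf 0 b l1 l2 0 0 0 c3)"
  "jordan_superalgebra (nf a 0 l1 0 l3 0 c2 0)"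
  by (rule jordan_superalgebra_nfI, elim insertE emptyE,
      simp_all add: hpart_def even_part_nf odd_part_nf jordan_defect_def mul_nf vec_gen_eq_iff algebra_simps)+

text \<open>A product can only involve basis vectors whose weight is at least the sum of the weights of its factors.
The k-th power therefore lies in the span of the basis vectors of weight at least k, which is 0 for large k.\<close>

lemma superalg_nilpotent_nf:
  fixes w :: "gen \<Rightarrow> nat"
  assumes pos: "\<And>g. 0 < w g"
    and a: "a = 0 \<or> w E1 + w E1 \<le> w E2" and b: "b = 0 \<or> w E1 + w E2 \<le> w E3"
    and l1: "l1 = 0 \<or> w E1 + w F2 \<le> w F1" and l2: "l2 = 0 \<or> w E2 + w F2 \<le> w F1"
    and l3: "l3 = 0 \<or> w E3 + w F2 \<le> w F1"
    and c1: "c1 = 0 \<or> w F1 + w F2 \<le> w E1" and c2: "c2 = 0 \<or> w F1 + w F2 \<le> w E2"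
    and c3: "c3 = 0 \<or> w F1 + w F2 \<le> w E3"
  shows "superalg_nilpotent (nf a b l1 l2 l3 c1 c2 c3)"
proof -
  let ?A = "nf a b l1 l2 l3 c1 c2 c3"
  define V where "V k = {x :: complex ^ gen. \<forall>g. w g < k \<longrightarrow> x $ g = 0}" for k
  have sub: "vec.subspace (V k)" for k
    by (auto simp: vec.subspace_def V_def)
  have mult: "mul ?A x y \<in> V (i + j)" if x: "x \<in> V i" and y: "y \<in> V j" for x y i j
  proof -
    have *: "x $ g * y $ h = 0" if "w g + w h < i + j" for g h
    proof -
      have "w g < i \<or> w h < j" using that by linarith
      then show ?thesis using x y by (auto simp: V_def)
    qed
    have **: "t * x $ g * y $ h = 0 \<and> t * x $ h * y $ g = 0"
      if "t = 0 \<or> w g + w h \<le> w k" "w k < i + j" for t g h k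
      using that *[of g h] *[of h g] by (cases "t = 0") (simp_all add: mult.assoc)
    have "mul ?A x y $ E1 = 0" if "w E1 < i + j"
    proof -
      have "mul ?A x y $ E1 = c1 * x $ F1 * y $ F2 - c1 * x $ F2 * y $ F1"
        by (simp add: mul_nf algebra_simps)
      then show ?thesis by (simp only: **[OF c1 that] diff_self)
    qed
    moreover have "mul ?A x y $ E2 = 0" if "w E2 < i + j"
    proof -
      have "mul ?A x y $ E2 = a * x $ E1 * y $ E1 + (c2 * x $ F1 * y $ F2 - c2 * x $ F2 * y $ F1)"
        by (simp add: mul_nf algebra_simps)
      then show ?thesis by (simp only: **[OF a that] **[OF c2 that] diff_self add_0)
    qed
    moreover have "mul ?A x y $ E3 = 0" if "w E3 < i + j"
    proof -
      have "mul ?A x y $ E3 = b * x $ E1 * y $ E2 + b * x $ E2 * y $ E1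
          + (c3 * x $ F1 * y $ F2 - c3 * x $ F2 * y $ F1)"
        by (simp add: mul_nf algebra_simps)
      then show ?thesis by (simp only: **[OF b that] **[OF c3 that] diff_self add_0)
    qed
    moreover have "mul ?A x y $ F1 = 0" if "w F1 < i + j"
    proof -
      have "mul ?A x y $ F1 = l1 * x $ E1 * y $ F2 + l1 * x $ F2 * y $ E1 + l2 * x $ E2 * y $ F2
          + l2 * x $ F2 * y $ E2 + l3 * x $ E3 * y $ F2 + l3 * x $ F2 * y $ E3"
        by (simp add: mul_nf algebra_simps)
      then show ?thesis by (simp only: **[OF l1 that] **[OF l2 that] **[OF l3 that] add_0)
    qed
    ultimately show ?thesis by (simp add: V_def all_gen mul_nf)
  qed
  have pow: "superalg_pow ?A k \<subseteq> V k" for k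
  proof (induction k rule: less_induct)
    case (less k)
    consider "k \<le> 1" | n where "k = Suc (Suc n)" by (cases k; cases "k - 1") auto
    then show ?case
    proof cases
      case 1
      then have "\<not> w g < k" for g using pos[of g] by linarith
      then show ?thesis by (simp add: V_def)
    next
      case (2 n)
      have prods: "subspace_mul ?A (superalg_pow ?A i) (superalg_pow ?A (k - i)) \<subseteq> V k"
        if i: "i \<in> {1..Suc n}" for i
      proof -
        have "superalg_pow ?A i \<subseteq> V i" "superalg_pow ?A (k - i) \<subseteq> V (k - i)" and k: "i + (k - i) = k"
          using less[of i] less[of "k - i"] i 2 by auto
        then have "mul ?A x y \<in> V k" if "x \<in> superalg_pow ?A i" "y \<in> superalg_pow ?A (k - i)" for x y
          using mult[of x i y "k - i"] that by auto
        then show ?thesis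
          unfolding subspace_mul_def smul_nf by (intro vec.span_minimal sub) auto
      qed
      show ?thesis
        unfolding 2 superalg_pow.simps smul_nf
        by (rule vec.span_minimal[OF UN_least[OF prods[unfolded 2]] sub])
    qed
  qed
  \<comment> \<open>Any number above all weights.\<close>
  define k where "k = Suc (\<Sum>g\<in>UNIV. w g)"
  have "w g < k" for g unfolding k_def by (simp add: less_Suc_eq_le member_le_sum)
  then have "V k = {0}" by (auto simp: V_def vec_eq_iff)
  moreover have "0 \<in> superalg_pow ?A k" 
    unfolding k_def by (cases "\<Sum>g\<in>UNIV. w g") (simp_all add: vec.span_zero)
  ultimately have "superalg_pow ?A k = {0}" using pow[of k] by auto
  then show ?thesis unfolding superalg_nilpotent_def by (intro exI[where x=k]) (simp add: k_def)
qed

lemma has_type_nf: "has_type (nf a b l1 l2 l3 c1 c2 c3) 3 2"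
proof -
  let ?A = "nf a b l1 l2 l3 c1 c2 c3"
  have ind: "vec.independent S" if "S \<subseteq> range bv" for S
  proof (rule vec.independent_mono[OF independent_cart_basis])
    show "S \<subseteq> cart_basis" using that unfolding cart_basis_def by blast
  qed
  have eq: "x = (\<Sum>g\<in>UNIV. x $ g *s bv g)" for x :: "complex ^ gen"
    by (simp add: UNIV_gen vec_gen_eq_iff axis_def)
  have [simp]: "bv g = bv h \<longleftrightarrow> g = h" for g h by (simp add: axis_eq_axis)
  have "vec.dim (even_part ?A) = 3"
  proof (rule vec.dim_unique)
    show "{bv E1, bv E2, bv E3} \<subseteq> even_part ?A" by (auto simp: even_part_nf axis_def)
    show "even_part ?A \<subseteq> vec.span {bv E1, bv E2, bv E3}"
    proof
      fix x assume "x \<in> even_part ?A"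
      then have "x = x $ E1 *s bv E1 + x $ E2 *s bv E2 + x $ E3 *s bv E3"
        by (subst eq) (simp add: UNIV_gen even_part_nf)
      then show "x \<in> vec.span {bv E1, bv E2, bv E3}" unfolding vec.in_span3 by blast
    qed
  qed (rule ind, auto)
  moreover have "vec.dim (odd_part ?A) = 2"
  proof (rule vec.dim_unique)
    show "{bv F1, bv F2} \<subseteq> odd_part ?A" by (auto simp: odd_part_nf axis_def)
    show "odd_part ?A \<subseteq> vec.span {bv F1, bv F2}"
    proof
      fix x assume "x \<in> odd_part ?A"
      then have "x = x $ F1 *s bv F1 + x $ F2 *s bv F2"
        by (subst eq) (simp add: UNIV_gen odd_part_nf)
      then show "x \<in> vec.span {bv F1, bv F2}" unfolding vec.in_span2 by blast
    qed
  qed (rule ind, auto)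
  ultimately show ?thesis by (simp add: has_type_def)
qed

lemma nilp_3_2_nilpotent_jordan:
  assumes "n \<in> {1..29}"
  shows "jordan_superalgebra (nilp_3_2 n) \<and> superalg_nilpotent (nilp_3_2 n) \<and> has_type (nilp_3_2 n) 3 2"
proof -
  have n: "n \<in> {1, 2, 3, 4, 5, 6, 7, 8, 9, 10, 11, 12, 13, 14, 15, 16, 17, 18, 19, 20, 21, 22, 23,
      24, 25, 26, 27, 28, 29}"
    using assms by (simp add: atLeastAtMost_iff) presburger
  have "jordan_superalgebra (nilp_3_2 n)"
    using n by (elim insertE emptyE) (simp_all only: nilp_3_2_eq_nf jordan_superalgebra_nf)
  moreover have "superalg_nilpotent (nilp_3_2 n)"
  proof -
    \<comment> \<open>The weights of e1, e2, e3, f1, f2. The first choice serves \<open>l = 0\<close>, where only c bounds the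
      even weights from below by those of f1 and f2; in the others f1 must outweigh every \<open>e_i\<close> with \<open>l(e_i) \<noteq> 0\<close> and be
      outweighed by the basis vectors that occur in c.\<close>
    have "superalg_nilpotent (nilp_3_2 n)" if "n \<in> {1, 2, 5, 6, 7, 8, 15, 16, 17, 18, 24, 25, 26}"
      using that by (elim insertE emptyE; simp only: nilp_3_2_eq_nf;
        intro superalg_nilpotent_nf[of "case_gen 2 4 6 1 1"]; simp split: gen.split)
    moreover have "superalg_nilpotent (nilp_3_2 n)" if "n \<in> {3, 4, 12, 13, 14, 20, 21, 28, 29}"
      using that by (elim insertE emptyE; simp only: nilp_3_2_eq_nf;
        intro superalg_nilpotent_nf[of "case_gen 1 3 4 2 1"]; simp split: gen.split)
    moreover have "superalg_nilpotent (nilp_3_2 n)" if "n \<in> {10, 11}"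
      using that by (elim insertE emptyE; simp only: nilp_3_2_eq_nf;
        intro superalg_nilpotent_nf[of "case_gen 1 3 1 2 1"]; simp split: gen.split)
    moreover have "superalg_nilpotent (nilp_3_2 n)" if "n \<in> {9, 22, 23, 27}"
      using that by (elim insertE emptyE; simp only: nilp_3_2_eq_nf;
        intro superalg_nilpotent_nf[of "case_gen 1 2 4 3 1"]; simp split: gen.split)
    moreover have "superalg_nilpotent (nilp_3_2 n)" if "n = 19"
      using that by (simp only: nilp_3_2_eq_nf)
        (intro superalg_nilpotent_nf[of "case_gen 1 1 2 3 1"]; simp split: gen.split)
    ultimately show ?thesis using n by blast
  qed
  moreover have "has_type (nilp_3_2 n) 3 2"
    using n by (elim insertE emptyE) (simp_all only: nilp_3_2_eq_nf has_type_nf)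
  ultimately show ?thesis by blast
qed

section \<open>Reduction to the family of tables\<close>

lemma jordan_defect_zero_of_iso:
  assumes J: "jordan_superalgebra A" and iso: "superalg_iso B A"
    and p: "p \<in> {0, 1}" "q \<in> {0, 1}" "r \<in> {0, 1}" "s \<in> {0, 1}"
    and h: "w \<in> hpart B p" "x \<in> hpart B q" "y \<in> hpart B r" "z \<in> hpart B s"
  shows "jordan_defect B p q r s w x y z = 0"
proof -
  from iso obtain \<phi> where lin: "Vector_Spaces.linear (smul B) (smul A) \<phi>" and bij: "bij \<phi>"
    and hom: "\<forall>x y. \<phi> (mul B x y) = mul A (\<phi> x) (\<phi> y)"
    and parts: "\<phi> ` even_part B = even_part A" "\<phi> ` odd_part B = odd_part A"
    unfolding superalg_iso_def by blast
  interpret \<phi>: Vector_Spaces.linear "smul B" "smul A" \<phi> by (rule lin)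
  have hp: "\<phi> u \<in> hpart A i" if "u \<in> hpart B i" for u i
    using that parts by (auto simp: hpart_def)
  have "\<phi> (jordan_defect B p q r s w x y z) = jordan_defect A p q r s (\<phi> w) (\<phi> x) (\<phi> y) (\<phi> z)"
    by (simp add: jordan_defect_def \<phi>.add \<phi>.diff \<phi>.scale hom)
  also have "\<dots> = 0"
    unfolding jordan_defect_def
    by (rule jordan_superalgebra.jordan_superidentity[OF J p h[THEN hp]])
  finally have "\<phi> (jordan_defect B p q r s w x y z) = \<phi> 0" by (simp add: \<phi>.zero)
  then show ?thesis using injD[OF bij_is_inj[OF bij]] by blast
qed

text \<open>In coordinates, with A the even part: l vanishes on A A A, c annihilates A A,
\<open>l(y) zc + l(z) yc = l(yz) c\<close> for y and z in the even basis, and \<open>l(c) = 0\<close>.\<close>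

definition nf_conditions :: "complex \<Rightarrow> complex \<Rightarrow> complex \<Rightarrow> complex \<Rightarrow> complex \<Rightarrow> complex \<Rightarrow> complex \<Rightarrow> complex \<Rightarrow> bool"
  where "nf_conditions a b l1 l2 l3 c1 c2 c3 \<longleftrightarrow>
    a * b * l3 = 0 \<and> a * b * c1 = 0 \<and>
    a * l2 * c1 = 0 \<and> 2 * a * l1 * c1 = a * l2 * c2 \<and> 2 * b * l1 * c2 = a * l2 * c3 \<and>
    b * l3 * c1 = 0 \<and> a * l2 * c1 = b * l3 * c2 \<and> b * l1 * c1 + b * l2 * c2 = b * l3 * c3 \<and>
    b * l2 * c1 = 0 \<and> a * l3 * c1 = 0 \<and> b * l3 * c2 = 0 \<and>
    l1 * c1 + l2 * c2 + l3 * c3 = 0"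

text \<open>The equation \<open>l(c) = 0\<close> comes from nilpotency: \<open>(f1 f2) f2 = l(c) f1\<close>, so otherwise f1 and \<open>f1 f2\<close>
could be recovered from their products with f2. The others are values of the superidentity at basis
vectors, two of which are even and two odd, or three even and one odd.\<close>

lemma nf_conditions_of_jordan:
  fixes a b l1 l2 l3 c1 c2 c3
  defines "B \<equiv> nf a b l1 l2 l3 c1 c2 c3"
  assumes J: "jordan_superalgebra A" and nil: "superalg_nilpotent A" and iso: "superalg_iso B A"
  shows "nf_conditions a b l1 l2 l3 c1 c2 c3"
proof -
  interpret jordan_superalgebra A by (rule J)
  note defect = jordan_defect_zero_of_iso[OF J iso[unfolded B_def]]
  have ev: "bv E1 \<in> hpart (nf a b l1 l2 l3 c1 c2 c3) 0" "bv E2 \<in> hpart (nf a b l1 l2 l3 c1 c2 c3) 0"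
      "bv E3 \<in> hpart (nf a b l1 l2 l3 c1 c2 c3) 0"
    and od: "bv F1 \<in> hpart (nf a b l1 l2 l3 c1 c2 c3) 1" "bv F2 \<in> hpart (nf a b l1 l2 l3 c1 c2 c3) 1"
    by (simp_all add: hpart_def even_part_nf odd_part_nf axis_def)
  note [simp] = jordan_defect_def mul_nf vec_gen_eq_iff axis_def
  have "l1 * c1 + l2 * c2 + l3 * c3 = 0" (is "?k = 0")
  proof (rule ccontr)
    assume k: "?k \<noteq> 0"
    obtain \<phi> where lin: "Vector_Spaces.linear (*s) (smul A) \<phi>" and bij: "bij \<phi>"
      and hom: "\<forall>x y. \<phi> (mul B x y) = mul A (\<phi> x) (\<phi> y)"
      using iso unfolding superalg_iso_def B_def smul_nf by blast
    interpret \<phi>: Vector_Spaces.linear "(*s)" "smul A" \<phi> by (rule lin)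
    define c where "c = mul B (bv F1) (bv F2)"
    have "bv F1 = (1 / ?k) *s mul B c (bv F2)"
      using k by (simp add: c_def B_def algebra_simps)
    then have "\<phi> (bv F1) = \<phi> ((1 / ?k) *s mul B c (bv F2))" by (rule arg_cong)
    then have f1: "\<phi> (bv F1) = smul A (1 / ?k) (mul A (\<phi> c) (\<phi> (bv F2)))" by (simp only: \<phi>.scale hom)
    have c: "\<phi> c = mul A (\<phi> (bv F1)) (\<phi> (bv F2))" by (simp add: c_def hom)
    have "\<phi> (bv F1) = 0"
    proof (rule superalg_nilpotent_vanish[OF nil, of "{\<phi> (bv F1), \<phi> c}"])
      let ?S = "span {mul A x y | x y. x \<in> {\<phi> (bv F1), \<phi> c} \<or> y \<in> {\<phi> (bv F1), \<phi> c}}"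
      have "smul A (1 / ?k) (mul A (\<phi> c) (\<phi> (bv F2))) \<in> ?S" by (intro span_scale span_base) blast
      moreover have "mul A (\<phi> (bv F1)) (\<phi> (bv F2)) \<in> ?S" by (intro span_base) blast
      ultimately show "v \<in> ?S" if "v \<in> {\<phi> (bv F1), \<phi> c}" for v
        using that f1 c by (elim insertE emptyE) simp_all
    qed simp
    then have "\<phi> (bv F1) = \<phi> 0" by (simp add: \<phi>.zero)
    then have "bv F1 = 0" by (rule injD[OF bij_is_inj[OF bij]])
    then show False by simp
  qed
  moreover have "a * b * l3 = 0"
    using defect[OF _ _ _ _ ev(1) od(2) ev(1) ev(1)] by auto
  moreover have "a * b * c1 = 0"
    using defect[OF _ _ _ _ od(1) od(2) ev(1) ev(1)] by auto
  moreover have "a * l2 * c1 = 0 \<and> 2 * a * l1 * c1 = a * l2 * c2 \<and> 2 * b * l1 * c2 = a * l2 * c3"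
    using defect[OF _ _ _ _ od(2) od(2) ev(1) ev(1)] by (simp add: algebra_simps)
  moreover have "b * l3 * c1 = 0 \<and> a * l2 * c1 = b * l3 * c2 \<and> b * l1 * c1 + b * l2 * c2 = b * l3 * c3"
    using defect[OF _ _ _ _ od(2) od(2) ev(1) ev(2)] by (simp add: algebra_simps)
  moreover have "b * l2 * c1 = 0"
    using defect[OF _ _ _ _ od(2) od(2) ev(2) ev(2)] by (simp add: algebra_simps)
  moreover have "a * l3 * c1 = 0 \<and> b * l3 * c2 = 0"
    using defect[OF _ _ _ _ od(2) od(2) ev(1) ev(3)] by (simp add: algebra_simps)
  ultimately show ?thesis unfolding nf_conditions_def by blast
qed

context jordan_superalgebra
begin

lemma nf_iso_exists:
  assumes nil: "superalg_nilpotent A" and type: "has_type A 3 2"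
  obtains a b l1 l2 l3 c1 c2 c3 where "a \<in> {0, 1}" "b \<in> {0, 1}"
    "superalg_iso (nf a b l1 l2 l3 c1 c2 c3) A"
proof -
  have dims: "dim (even_part A) = 3" "dim (odd_part A) = 2" using type by (simp_all add: has_type_def)
  obtain a b e1 e2 e3 where ab: "a \<in> {0, 1}" "b \<in> {0, 1}" and frame: "even_frame a b e1 e2 e3"
    using even_frame_exists[OF nil dims(1)] .
  obtain f1 f2 where f: "basis2 (smul A) (odd_part A) f1 f2"
    and ef1: "\<And>x. x \<in> even_part A \<Longrightarrow> x \<star> f1 = 0"
    and ef2: "\<And>x. x \<in> even_part A \<Longrightarrow> \<exists>k. x \<star> f2 = smul A k f1"
    by (rule odd_frame_exists[OF nil dims(2)]) blast
  have e: "basis3 (smul A) (even_part A) e1 e2 e3" using frame by (simp add: even_frame_def)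
  have ein: "e1 \<in> even_part A" "e2 \<in> even_part A" "e3 \<in> even_part A"
    and fin: "f1 \<in> odd_part A" "f2 \<in> odd_part A"
    using e f by (simp_all add: basis3_def basis2_def)
  obtain l1 l2 l3 where l: "e1 \<star> f2 = smul A l1 f1" "e2 \<star> f2 = smul A l2 f1" "e3 \<star> f2 = smul A l3 f1"
    using ef2[OF ein(1)] ef2[OF ein(2)] ef2[OF ein(3)] by blast
  have "f1 \<star> f2 \<in> even_part A" using fin by (rule odd_mul_odd)
  then obtain c1 c2 c3 where c: "f1 \<star> f2 = smul A c1 e1 + smul A c2 e2 + smul A c3 e3"
    using e unfolding basis3_def by metis
  note ee = frame[unfolded even_frame_def]
  have products: "e1 \<star> e1 = smul A a e2" "e1 \<star> e2 = smul A b e3" "e1 \<star> e3 = 0"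
    "e2 \<star> e1 = smul A b e3" "e2 \<star> e2 = 0" "e2 \<star> e3 = 0"
    "e3 \<star> e1 = 0" "e3 \<star> e2 = 0" "e3 \<star> e3 = 0"
    "e1 \<star> f1 = 0" "e2 \<star> f1 = 0" "e3 \<star> f1 = 0" "f1 \<star> e1 = 0" "f1 \<star> e2 = 0" "f1 \<star> e3 = 0"
    "f2 \<star> e1 = smul A l1 f1" "f2 \<star> e2 = smul A l2 f1" "f2 \<star> e3 = smul A l3 f1"
    "f1 \<star> f1 = 0" "f2 \<star> f2 = 0" "f2 \<star> f1 = - (f1 \<star> f2)"
    using ee l ein fin
    by (simp_all add: ef1 even_commute[of e2 e1] even_commute[of e3 e1] even_commute[of e3 e2]
        odd_even_commute odd_square odd_anticommute[of f2 f1])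
  let ?B = "nf a b l1 l2 l3 c1 c2 c3"
  define \<phi>0 where "\<phi>0 x = smul A (x $ E1) e1 + smul A (x $ E2) e2 + smul A (x $ E3) e3" for x :: "complex ^ gen"
  define \<phi>1 where "\<phi>1 x = smul A (x $ F1) f1 + smul A (x $ F2) f2" for x :: "complex ^ gen"
  define \<phi> where "\<phi> x = \<phi>0 x + \<phi>1 x" for x
  have in0: "\<phi>0 x \<in> even_part A" and in1: "\<phi>1 x \<in> odd_part A" for x
    using ein fin by (simp_all add: \<phi>0_def \<phi>1_def even_intros odd_intros)
  have lin: "Vector_Spaces.linear (*s) (smul A) \<phi>"
    by (simp add: Vector_Spaces.linear_iff vec.vector_space_axioms vector_space_axioms \<phi>_def \<phi>0_def
        \<phi>1_def scale_left_distrib scale_right_distrib algebra_simps)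
  have hom: "\<phi> (mul ?B x y) = \<phi> x \<star> \<phi> y" for x y
    by (simp add: \<phi>_def \<phi>0_def \<phi>1_def mul_nf mul_expand products l c scale_left_distrib
        scale_left_diff_distrib scale_right_distrib algebra_simps)
  have "x = 0" if "\<phi> x = 0" for x
  proof -
    have "\<phi>0 x = - \<phi>1 x" using that by (simp add: \<phi>_def eq_neg_iff_add_eq_0)
    then have "\<phi>0 x \<in> odd_part A" using in1[of x] by (simp add: odd_intros)
    then have z: "\<phi>0 x = 0" using in0[of x] parts_Int by blast
    then have "\<phi>1 x = 0" using that by (simp add: \<phi>_def)
    then have "x $ F1 = 0 \<and> x $ F2 = 0" using f unfolding basis2_def \<phi>1_def by blast
    moreover have "x $ E1 = 0 \<and> x $ E2 = 0 \<and> x $ E3 = 0" 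
      using z e unfolding basis3_def \<phi>0_def by blast
    ultimately show ?thesis by (simp add: vec_gen_eq_iff)
  qed
  then have inj: "inj \<phi>"
    using module_hom.diff[OF lin[folded module_hom_iff_linear]] by (intro injI) (metis eq_iff_diff_eq_0)
  have ev: "\<phi> ` even_part ?B = even_part A"
  proof (intro subset_antisym subsetI)
    fix v assume "v \<in> \<phi> ` even_part ?B"
    then obtain x where "v = \<phi> x" "x \<in> even_part ?B" by blast
    then show "v \<in> even_part A" using in0[of x] by (simp add: \<phi>_def \<phi>1_def even_part_nf)
  next
    fix v assume "v \<in> even_part A"
    then obtain p q r where "v = smul A p e1 + smul A q e2 + smul A r e3"
      using e unfolding basis3_def by metis
    then have "v = \<phi> (p *s bv E1 + q *s bv E2 + r *s bv E3)"
      by (simp add: \<phi>_def \<phi>0_def \<phi>1_def axis_def)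
    moreover have "p *s bv E1 + q *s bv E2 + r *s bv E3 \<in> even_part ?B"
      by (simp add: even_part_nf axis_def)
    ultimately show "v \<in> \<phi> ` even_part ?B" by blast
  qed
  have od: "\<phi> ` odd_part ?B = odd_part A"
  proof (intro subset_antisym subsetI)
    fix v assume "v \<in> \<phi> ` odd_part ?B"
    then obtain x where "v = \<phi> x" "x \<in> odd_part ?B" by blast
    then show "v \<in> odd_part A" using in1[of x] by (simp add: \<phi>_def \<phi>0_def odd_part_nf)
  next
    fix v assume "v \<in> odd_part A"
    then obtain p q where "v = smul A p f1 + smul A q f2"
      using f unfolding basis2_def by metis
    then have "v = \<phi> (p *s bv F1 + q *s bv F2)"
      by (simp add: \<phi>_def \<phi>0_def \<phi>1_def axis_def)
    moreover have "p *s bv F1 + q *s bv F2 \<in> odd_part ?B"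
      by (simp add: odd_part_nf axis_def)
    ultimately show "v \<in> \<phi> ` odd_part ?B" by blast
  qed
  have "surj \<phi>"
  proof (rule surj_def[THEN iffD2], rule allI)
    fix v
    obtain u t where "u \<in> even_part A" "t \<in> odd_part A" and v: "v = u + t" using parts_sum by blast
    then obtain x y where "u = \<phi> x" "t = \<phi> y" using ev od by blast
    then have "v = \<phi> (x + y)" using lin v by (simp add: Vector_Spaces.linear_iff)
    then show "\<exists>x. v = \<phi> x" by blast
  qed
  then have "superalg_iso ?B A"
    unfolding superalg_iso_def smul_nf using lin inj hom ev od by (blast intro: bijI)
  then show ?thesis using that ab by blast
qed

end

section \<open>Orbits under change of basis\<close>

definition det3 :: "complex \<Rightarrow> complex \<Rightarrow> complex \<Rightarrow> complex \<Rightarrow> complex \<Rightarrow> complex \<Rightarrow> complex \<Rightarrow> complex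
    \<Rightarrow> complex \<Rightarrow> complex"
  where "det3 m11 m12 m13 m21 m22 m23 m31 m32 m33 = m11 * (m22 * m33 - m23 * m32)
    - m12 * (m21 * m33 - m23 * m31) + m13 * (m21 * m32 - m22 * m31)"

text \<open>The columns of the matrix are the new even basis vectors in terms of the old ones, s is the factor by
which the form l is rescaled and t the one for c. The hypotheses say that the new basis multiplies as
in the table with the primed parameters.\<close>

lemma nf_iso_of_base_change:
  fixes m11 m12 m13 m21 m22 m23 m31 m32 m33 s t :: complex
  assumes det: "det3 m11 m12 m13 m21 m22 m23 m31 m32 m33 \<noteq> 0" and s: "s \<noteq> 0" and t: "t \<noteq> 0"
    and E11: "a' * m12 = 0 \<and> a' * m22 = a * m11\<^sup>2 \<and> a' * m32 = 2 * b * m11 * m21"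
    and E12: "b' * m13 = 0 \<and> b' * m23 = a * m11 * m12 \<and> b' * m33 = b * (m11 * m22 + m21 * m12)"
    and E13: "a * m11 * m13 = 0 \<and> b * (m11 * m23 + m21 * m13) = 0"
    and E22: "a * m12 = 0 \<and> b * m12 * m22 = 0"
    and E23: "a * m12 * m13 = 0 \<and> b * (m12 * m23 + m22 * m13) = 0"
    and E33: "a * m13 = 0 \<and> b * m13 * m23 = 0"
    and l: "l1' = s * (l1 * m11 + l2 * m21 + l3 * m31)" "l2' = s * (l1 * m12 + l2 * m22 + l3 * m32)"
      "l3' = s * (l1 * m13 + l2 * m23 + l3 * m33)"
    and c: "t * c1 = m11 * c1' + m12 * c2' + m13 * c3'" "t * c2 = m21 * c1' + m22 * c2' + m23 * c3'"
      "t * c3 = m31 * c1' + m32 * c2' + m33 * c3'"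
  shows "superalg_iso (nf a' b' l1' l2' l3' c1' c2' c3') (nf a b l1 l2 l3 c1 c2 c3)"
proof -
  let ?A = "nf a' b' l1' l2' l3' c1' c2' c3'" and ?B = "nf a b l1 l2 l3 c1 c2 c3"
  \<comment> \<open>Replacing f1, f2 by \<open>p f1\<close>, \<open>r f2\<close> multiplies l by \<open>r / p\<close> and c by \<open>p r\<close>; these are to be s and t.\<close>
  define r where "r = csqrt (s * t)"
  define p where "p = r / s"
  have rr: "r * r = s * t" using power2_csqrt[of "s * t"] by (simp add: r_def power2_eq_square)
  have r: "r \<noteq> 0" "p \<noteq> 0" using s t rr by (auto simp: p_def)
  have ps: "p * s = r" and pr: "p * r = t" using s rr by (simp_all add: p_def)
  define \<phi> :: "complex ^ gen \<Rightarrow> complex ^ gen" where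
    "\<phi> x = (\<chi> g. case g of
       E1 \<Rightarrow> m11 * x $ E1 + m12 * x $ E2 + m13 * x $ E3
     | E2 \<Rightarrow> m21 * x $ E1 + m22 * x $ E2 + m23 * x $ E3
     | E3 \<Rightarrow> m31 * x $ E1 + m32 * x $ E2 + m33 * x $ E3
     | F1 \<Rightarrow> p * x $ F1 | F2 \<Rightarrow> r * x $ F2)" for x
  have \<phi>: "\<phi> x $ E1 = m11 * x $ E1 + m12 * x $ E2 + m13 * x $ E3"
    "\<phi> x $ E2 = m21 * x $ E1 + m22 * x $ E2 + m23 * x $ E3"
    "\<phi> x $ E3 = m31 * x $ E1 + m32 * x $ E2 + m33 * x $ E3"
    "\<phi> x $ F1 = p * x $ F1" "\<phi> x $ F2 = r * x $ F2" for x
    by (simp_all add: \<phi>_def)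
  have lin: "Vector_Spaces.linear (*s) (*s) \<phi>"
    by (simp add: Vector_Spaces.linear_iff vec.vector_space_axioms vec_gen_eq_iff \<phi> algebra_simps)
  have even0: "x $ E1 = 0 \<and> x $ E2 = 0 \<and> x $ E3 = 0"
    if eq: "\<phi> x $ E1 = 0" "\<phi> x $ E2 = 0" "\<phi> x $ E3 = 0" for x
  proof -
    \<comment> \<open>The rows of the adjugate matrix, applied to the even part of the image of x.\<close>
    let ?d = "det3 m11 m12 m13 m21 m22 m23 m31 m32 m33"
    have "?d * x $ E1 = (m22 * m33 - m23 * m32) * \<phi> x $ E1 - (m12 * m33 - m13 * m32) * \<phi> x $ E2
        + (m12 * m23 - m13 * m22) * \<phi> x $ E3"
      "?d * x $ E2 = - (m21 * m33 - m23 * m31) * \<phi> x $ E1 + (m11 * m33 - m13 * m31) * \<phi> x $ E2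
        - (m11 * m23 - m13 * m21) * \<phi> x $ E3"
      "?d * x $ E3 = (m21 * m32 - m22 * m31) * \<phi> x $ E1 - (m11 * m32 - m12 * m31) * \<phi> x $ E2
        + (m11 * m22 - m12 * m21) * \<phi> x $ E3"
      unfolding \<phi> det3_def by algebra+
    then have "?d * x $ E1 = 0" "?d * x $ E2 = 0" "?d * x $ E3 = 0" by (simp_all only: eq mult_zero_right add_0 diff_self)
    then show ?thesis using det by (metis mult_eq_0_iff)
  qed
  have "x = 0" if "\<phi> x = 0" for x
  proof -
    have z: "\<phi> x $ g = 0" for g using that by simp
    have "x $ F1 = 0" "x $ F2 = 0" using z[of F1] z[of F2] r unfolding \<phi> by simp_all
    then show ?thesis using even0[OF z z z] by (simp add: vec_gen_eq_iff)
  qed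
  then have inj: "inj \<phi>"
    using module_hom.diff[OF lin[folded module_hom_iff_linear]] by (intro injI) (metis eq_iff_diff_eq_0)
  then have surj: "surj \<phi>" by (rule vec.linear_inj_imp_surj[OF lin])
  have hom: "\<phi> (mul ?A x y) = mul ?B (\<phi> x) (\<phi> y)" for x y
  proof -
    \<comment> \<open>Both sides are expanded into products of basis vectors: \<open>w\<close> is the coefficient of the product of the
      odd ones, and \<open>q g h\<close> of that of two distinct even ones g and h.\<close>
    define w where "w = x $ F1 * y $ F2 - x $ F2 * y $ F1"
    define q where "q g h = x $ g * y $ h + x $ h * y $ g" for g h
    have pw: "p * x $ F1 * (r * y $ F2) - r * x $ F2 * (p * y $ F1) = t * w"
      unfolding pr[symmetric] w_def by (simp add: algebra_simps)
    have "\<phi> (mul ?A x y) $ E1 = (m11 * c1' + m12 * c2' + m13 * c3') * w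
        + (a' * m12) * (x $ E1 * y $ E1) + (b' * m13) * q E1 E2"
      unfolding \<phi> mul_nf w_def q_def by (simp add: algebra_simps)
    also have "\<dots> = t * c1 * w" by (simp only: E11 E12 c[symmetric] mult_zero_left add_0_right)
    also have "\<dots> = mul ?B (\<phi> x) (\<phi> y) $ E1" unfolding \<phi> mul_nf pw by simp
    finally have 1: "\<phi> (mul ?A x y) $ E1 = mul ?B (\<phi> x) (\<phi> y) $ E1" .
    have "\<phi> (mul ?A x y) $ E2 = (m21 * c1' + m22 * c2' + m23 * c3') * w
        + (a' * m22) * (x $ E1 * y $ E1) + (b' * m23) * q E1 E2"
      unfolding \<phi> mul_nf w_def q_def by (simp add: algebra_simps)
    also have "\<dots> = t * c2 * w + (a * m11\<^sup>2) * (x $ E1 * y $ E1) + (a * m11 * m12) * q E1 E2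
        + (a * m11 * m13) * q E1 E3 + (a * m12) * m12 * (x $ E2 * y $ E2)
        + (a * m12 * m13) * q E2 E3 + (a * m13) * m13 * (x $ E3 * y $ E3)"
      by (simp only: E11 E12 E13 E22 E23 E33 c[symmetric] mult_zero_left mult_zero_right add_0_right)
    also have "\<dots> = mul ?B (\<phi> x) (\<phi> y) $ E2"
      unfolding \<phi> mul_nf pw q_def by (simp add: algebra_simps power2_eq_square)
    finally have 2: "\<phi> (mul ?A x y) $ E2 = mul ?B (\<phi> x) (\<phi> y) $ E2" .
    have "\<phi> (mul ?A x y) $ E3 = (m31 * c1' + m32 * c2' + m33 * c3') * w
        + (a' * m32) * (x $ E1 * y $ E1) + (b' * m33) * q E1 E2"
      unfolding \<phi> mul_nf w_def q_def by (simp add: algebra_simps)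
    also have "\<dots> = t * c3 * w + (2 * b * m11 * m21) * (x $ E1 * y $ E1)
        + (b * (m11 * m22 + m21 * m12)) * q E1 E2 + (b * (m11 * m23 + m21 * m13)) * q E1 E3
        + 2 * (b * m12 * m22) * (x $ E2 * y $ E2) + (b * (m12 * m23 + m22 * m13)) * q E2 E3
        + 2 * (b * m13 * m23) * (x $ E3 * y $ E3)"
      by (simp only: E11 E12 E13 E22 E23 E33 c[symmetric] mult_zero_left mult_zero_right add_0_right)
    also have "\<dots> = mul ?B (\<phi> x) (\<phi> y) $ E3"
      unfolding \<phi> mul_nf pw q_def by (simp add: algebra_simps)
    finally have 3: "\<phi> (mul ?A x y) $ E3 = mul ?B (\<phi> x) (\<phi> y) $ E3" .
    have "\<phi> (mul ?A x y) $ F1 = mul ?B (\<phi> x) (\<phi> y) $ F1"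
      unfolding \<phi> mul_nf l ps[symmetric] by (simp add: algebra_simps)
    then show ?thesis using 1 2 3 by (simp add: vec_gen_eq_iff \<phi>(5) mul_nf(5))
  qed
  have img: "\<phi> ` S = T" if iff: "\<And>x. \<phi> x \<in> T \<longleftrightarrow> x \<in> S" for S T
  proof (intro subset_antisym subsetI)
    fix v assume v: "v \<in> T"
    obtain x where "v = \<phi> x" using surj by (rule surjE)
    then show "v \<in> \<phi> ` S" using iff v by simp
  qed (auto simp: iff)
  have ev: "\<phi> ` even_part ?A = even_part ?B"
    by (rule img) (simp add: even_part_nf \<phi> r)
  have od: "\<phi> ` odd_part ?A = odd_part ?B"
  proof (rule img)
    show "\<phi> x \<in> odd_part ?B \<longleftrightarrow> x \<in> odd_part ?A" for x
    proof
      assume "\<phi> x \<in> odd_part ?B"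
      then show "x \<in> odd_part ?A" using even0[of x] unfolding odd_part_nf by blast
    qed (simp add: odd_part_nf \<phi>)
  qed
  show ?thesis
    unfolding superalg_iso_def smul_nf using lin bijI[OF inj surj] hom ev od by blast
qed


lemma nf_swap:
  "superalg_iso (nf 0 b l2 l1 l3 c2 c1 c3) (nf 0 b l1 l2 l3 c1 c2 c3)"
  by (rule nf_iso_of_base_change[of 0 1 0 1 0 0 0 0 1 1 1]) (simp_all add: det3_def)

lemma nf_swap_last:
  "superalg_iso (nf 0 0 l1 l3 l2 c1 c3 c2) (nf 0 0 l1 l2 l3 c1 c2 c3)"
  by (rule nf_iso_of_base_change[of 1 0 0 0 0 1 0 1 0 1 1]) (simp_all add: det3_def)

lemma superalg_iso_nf_refl: "superalg_iso (nf a b l1 l2 l3 c1 c2 c3) (nf a b l1 l2 l3 c1 c2 c3)"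
  unfolding superalg_iso_def smul_nf by (intro exI[of _ id]) (simp add: vec.linear_id)

definition is_listed :: "(complex ^ gen) superalg \<Rightarrow> bool" where
  "is_listed A \<longleftrightarrow> (\<exists>n\<in>{1..29}. superalg_iso (nilp_3_2 n) A)"

lemma is_listed_iso: "is_listed A \<Longrightarrow> superalg_iso A B \<Longrightarrow> is_listed B"
  unfolding is_listed_def using superalg_iso_trans by blast

lemma is_listedI:
  assumes "n \<in> {1..29}" "nilp_3_2 n = nf a' b' l1' l2' l3' c1' c2' c3'"
    and "superalg_iso (nf a' b' l1' l2' l3' c1' c2' c3') A"
  shows "is_listed A"
  using assms unfolding is_listed_def by metis

lemma is_listed_nf_00_no_action:
  assumes "c2 \<noteq> 0"
  shows "is_listed (nf 0 0 0 0 0 c1 c2 c3)"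
  by (rule is_listedI[OF _ nilp_3_2_eq_nf(2) nf_iso_of_base_change[of 1 c1 0 0 c2 0 0 c3 1 1 1]])
    (use assms in \<open>simp_all add: det3_def\<close>)

text \<open>Without even products every change of the even basis is allowed, and only l, c and \<open>l(c) = 0\<close> matter.
If \<open>l \<noteq> 0\<close>, then e1 is taken outside its kernel and e2, e3 in it, where c lies too; finally a nonzero c
is made a basis vector.\<close>

lemma is_listed_nf_00:
  assumes "nf_conditions 0 0 l1 l2 l3 c1 c2 c3"
  shows "is_listed (nf 0 0 l1 l2 l3 c1 c2 c3)"
proof -
  have lc: "l1 * c1 + l2 * c2 + l3 * c3 = 0" using assms by (simp add: nf_conditions_def)
  have step: "is_listed (nf 0 0 l1 l2 l3 c1 c2 c3)"
    if l1: "l1 \<noteq> 0" and lc: "l1 * c1 + l2 * c2 + l3 * c3 = 0" for l1 l2 l3 c1 c2 c3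
  proof -
    have base: "superalg_iso (nf 0 0 1 0 0 0 c2 c3) (nf 0 0 l1 l2 l3 c1 c2 c3)"
      by (rule nf_iso_of_base_change[of "1 / l1" "- l2 / l1" "- l3 / l1" 0 1 0 0 0 1 1 1])
        (use l1 lc in \<open>simp_all add: det3_def field_simps eq_neg_iff_add_eq_0\<close>)
    have two: "is_listed (nf 0 0 1 0 0 0 c2 c3)" if "c2 \<noteq> 0" for c2 c3
      by (rule is_listedI[OF _ nilp_3_2_eq_nf(4) nf_iso_of_base_change[of 1 0 0 0 c2 0 0 c3 1 1 1]])
        (use that in \<open>simp_all add: det3_def\<close>)
    have "is_listed (nf 0 0 1 0 0 0 c2 c3)"
    proof (cases "c2 = 0")
      case True
      show ?thesis
      proof (cases "c3 = 0")
        case True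
        with \<open>c2 = 0\<close> show ?thesis
          using is_listedI[OF _ nilp_3_2_eq_nf(3) superalg_iso_nf_refl] by simp
      next
        case False
        then show ?thesis using is_listed_iso[OF two nf_swap_last] by blast
      qed
    qed (rule two)
    then show ?thesis using base by (rule is_listed_iso)
  qed
  consider "l1 \<noteq> 0" | "l1 = 0" "l2 \<noteq> 0" | "l1 = 0" "l2 = 0" "l3 \<noteq> 0" | "l1 = 0" "l2 = 0" "l3 = 0"
    by blast
  then show ?thesis
  proof cases
    case 1
    then show ?thesis using lc by (rule step)
  next
    case 2
    then show ?thesis using lc by (intro is_listed_iso[OF step nf_swap]) simp_all
  next
    case 3
    then have "is_listed (nf 0 0 l1 l3 l2 c1 c3 c2)"
      using lc by (intro is_listed_iso[OF step nf_swap]) simp_all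
    then show ?thesis by (rule is_listed_iso) (rule nf_swap_last)
  next
    case 4
    consider "c2 \<noteq> 0" | "c1 \<noteq> 0" | "c3 \<noteq> 0" | "c1 = 0" "c2 = 0" "c3 = 0" by blast
    then show ?thesis
    proof cases
      case 1
      then show ?thesis unfolding 4 by (rule is_listed_nf_00_no_action)
    next
      case 2
      then show ?thesis unfolding 4 by (intro is_listed_iso[OF is_listed_nf_00_no_action nf_swap])
    next
      case 3
      then show ?thesis unfolding 4 by (intro is_listed_iso[OF is_listed_nf_00_no_action nf_swap_last])
    next
      case 4
      then show ?thesis
        unfolding 4 \<open>l1 = 0\<close> \<open>l2 = 0\<close> \<open>l3 = 0\<close>
        by (intro is_listedI[OF _ nilp_3_2_eq_nf(1) superalg_iso_nf_refl]) simp
    qed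
  qed
qed

text \<open>Adding multiples of e2 and e3 to e1, or of e2 to e3, changes neither \<open>e1 e1 = e2\<close> nor the vanishing of the
other products. This moves basis vectors into the kernel of l and, where e3 is free, turns c into e3. If \<open>c1 \<noteq> 0\<close>,
then \<open>l = 0\<close> and c itself can serve as e1.\<close>

lemma is_listed_nf_10:
  assumes "nf_conditions 1 0 l1 l2 l3 c1 c2 c3"
  shows "is_listed (nf 1 0 l1 l2 l3 c1 c2 c3)"
proof -
  have cond: "l2 * c1 = 0" "2 * l1 * c1 = l2 * c2" "l2 * c3 = 0" "l3 * c1 = 0"
    "l1 * c1 + l2 * c2 + l3 * c3 = 0"
    using assms by (simp_all add: nf_conditions_def)
  consider "l2 \<noteq> 0" | "l2 = 0" "l3 \<noteq> 0" | "l1 \<noteq> 0" "l2 = 0" "l3 = 0" | "l1 = 0" "l2 = 0" "l3 = 0"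
    by blast
  then show ?thesis
  proof cases
    case 1
    then have c: "c1 = 0" "c2 = 0" "c3 = 0" using cond by auto
    show ?thesis unfolding c
      by (rule is_listedI[OF _ nilp_3_2_eq_nf(9) nf_iso_of_base_change[of 1 0 0 "- l1 / l2" 1 "- l3 / l2" 0 0 1 "1 / l2" 1]])
        (use 1 in \<open>simp_all add: det3_def field_simps power2_eq_square\<close>)
  next
    case 2
    then have c: "c1 = 0" "c3 = 0" using cond by auto
    show ?thesis
    proof (cases "c2 = 0")
      case True
      show ?thesis unfolding c True \<open>l2 = 0\<close>
        by (rule is_listedI[OF _ nilp_3_2_eq_nf(10) nf_iso_of_base_change[of 1 0 0 0 1 0 "- l1 / l3" 0 1 "1 / l3" 1]])
        (use 2 in \<open>simp_all add: det3_def field_simps power2_eq_square\<close>)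
    next
      case False
      show ?thesis unfolding c \<open>l2 = 0\<close>
        by (rule is_listedI[OF _ nilp_3_2_eq_nf(11) nf_iso_of_base_change[of 1 0 0 0 1 0 "- l1 / l3" 0 1 "1 / l3" "1 / c2"]])
        (use 2 False in \<open>simp_all add: det3_def field_simps power2_eq_square\<close>)
    qed
  next
    case 3
    then have c: "c1 = 0" using cond by auto
    consider "c3 \<noteq> 0" | "c2 \<noteq> 0" "c3 = 0" | "c2 = 0" "c3 = 0" by blast
    then show ?thesis
    proof cases
      case 1
      show ?thesis unfolding c 3(2,3)
        by (rule is_listedI[OF _ nilp_3_2_eq_nf(14) nf_iso_of_base_change[of 1 0 0 0 1 c2 0 0 c3 "1 / l1" 1]])
        (use 1 3 in \<open>simp_all add: det3_def field_simps power2_eq_square\<close>)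
    next
      case 2
      show ?thesis unfolding c 2(2) 3(2,3)
        by (rule is_listedI[OF _ nilp_3_2_eq_nf(13) nf_iso_of_base_change[of 1 0 0 0 1 0 0 0 1 "1 / l1" "1 / c2"]])
        (use 2 3 in \<open>simp_all add: det3_def field_simps power2_eq_square\<close>)
    next
      case c23: 3
      show ?thesis unfolding c c23 3(2,3)
        by (rule is_listedI[OF _ nilp_3_2_eq_nf(12) nf_iso_of_base_change[of 1 0 0 0 1 0 0 0 1 "1 / l1" 1]])
        (use 3 in \<open>simp_all add: det3_def field_simps power2_eq_square\<close>)
    qed
  next
    case 4
    consider "c1 \<noteq> 0" | "c1 = 0" "c3 \<noteq> 0" | "c1 = 0" "c2 \<noteq> 0" "c3 = 0" | "c1 = 0" "c2 = 0" "c3 = 0"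
      by blast
    then show ?thesis
    proof cases
      case 1
      show ?thesis unfolding 4
        by (rule is_listedI[OF _ nilp_3_2_eq_nf(6) nf_iso_of_base_change[of c1 0 0 c2 "c1 ^ 2" 0 c3 0 1 1 1]])
        (use 1 in \<open>simp_all add: det3_def field_simps power2_eq_square\<close>)
    next
      case 2
      show ?thesis unfolding 4 2(1)
        by (rule is_listedI[OF _ nilp_3_2_eq_nf(8) nf_iso_of_base_change[of 1 0 0 0 1 c2 0 0 c3 1 1]])
        (use 2 in \<open>simp_all add: det3_def field_simps power2_eq_square\<close>)
    next
      case 3
      show ?thesis unfolding 4 3(1,3)
        by (rule is_listedI[OF _ nilp_3_2_eq_nf(7) nf_iso_of_base_change[of 1 0 0 0 1 0 0 0 1 1 "1 / c2"]])
        (use 3 in \<open>simp_all add: det3_def field_simps power2_eq_square\<close>)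
    next
      case c: 4
      show ?thesis unfolding 4 c
        using is_listedI[OF _ nilp_3_2_eq_nf(5) superalg_iso_nf_refl] by simp
    qed
  qed
qed

text \<open>Here e1 and e2 can be exchanged, rescaled independently and shifted by multiples of e3, and e3 is scaled by the
product of the two factors. The equations leave c = 0 if \<open>l3 \<noteq> 0\<close>, and c a multiple of e3 if
\<open>l \<noteq> 0 = l3\<close>; if \<open>l = 0\<close>, the components of c in e1 and e2 are absorbed into these vectors.\<close>

lemma is_listed_nf_01:
  assumes "nf_conditions 0 1 l1 l2 l3 c1 c2 c3"
  shows "is_listed (nf 0 1 l1 l2 l3 c1 c2 c3)"
proof -
  have cond: "l1 * c2 = 0" "l3 * c1 = 0" "l3 * c2 = 0" "l2 * c1 = 0"
    using assms by (simp_all add: nf_conditions_def)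
  have sums: "l1 * c1 + l2 * c2 = l3 * c3" "l1 * c1 + l2 * c2 + l3 * c3 = 0"
    using assms unfolding nf_conditions_def mult_1_left by blast+
  have "2 * (l3 * c3) = 0" using sums by (simp only: mult_2)
  then have l3c3: "l3 * c3 = 0" by simp
  have action: "is_listed (nf 0 1 l1 0 0 0 0 c3)" if "l1 \<noteq> 0" for l1 c3
  proof (cases "c3 = 0")
    case True
    show ?thesis unfolding True
      by (rule is_listedI[OF _ nilp_3_2_eq_nf(20) nf_iso_of_base_change[of 1 0 0 0 1 0 0 0 1 "1 / l1" 1]])
        (use that in \<open>simp_all add: det3_def field_simps power2_eq_square\<close>)
  next
    case False
    show ?thesis
      by (rule is_listedI[OF _ nilp_3_2_eq_nf(21) nf_iso_of_base_change[of 1 0 0 0 1 0 0 0 1 "1 / l1" "1 / c3"]])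
        (use that False in \<open>simp_all add: det3_def field_simps power2_eq_square\<close>)
  qed
  have const: "is_listed (nf 0 1 0 0 0 c1 0 c3)" if "c1 \<noteq> 0" for c1 c3
    by (rule is_listedI[OF _ nilp_3_2_eq_nf(16) nf_iso_of_base_change[of c1 0 0 0 1 0 c3 0 c1 1 1]])
        (use that in \<open>simp_all add: det3_def field_simps power2_eq_square\<close>)
  consider "l3 \<noteq> 0" | "l1 \<noteq> 0" "l2 \<noteq> 0" "l3 = 0" | "l1 \<noteq> 0" "l2 = 0" "l3 = 0"
    | "l1 = 0" "l2 \<noteq> 0" "l3 = 0" | "l1 = 0" "l2 = 0" "l3 = 0"
    by blast
  then show ?thesis
  proof cases
    case 1
    then have c: "c1 = 0" "c2 = 0" "c3 = 0" using cond sums l3c3 by auto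
    show ?thesis unfolding c
      by (rule is_listedI[OF _ nilp_3_2_eq_nf(19) nf_iso_of_base_change[of 1 0 0 0 1 0 "- l1 / l3" "- l2 / l3" 1 "1 / l3" 1]])
        (use 1 in \<open>simp_all add: det3_def field_simps power2_eq_square\<close>)
  next
    case 2
    then have c: "c1 = 0" "c2 = 0" using cond sums by auto
    show ?thesis
    proof (cases "c3 = 0")
      case True
      show ?thesis unfolding c True 2(3)
        by (rule is_listedI[OF _ nilp_3_2_eq_nf(22) nf_iso_of_base_change[of "1 / l1" 0 0 0 "1 / l2" 0 0 0 "1 / (l1 * l2)" 1 1]])
        (use 2 in \<open>simp_all add: det3_def field_simps power2_eq_square\<close>)
    next
      case False
      show ?thesis unfolding c 2(3)
        by (rule is_listedI[OF _ nilp_3_2_eq_nf(23) nf_iso_of_base_change[of "1 / l1" 0 0 0 "1 / l2" 0 0 0 "1 / (l1 * l2)" 1 "1 / (l1 * l2 * c3)"]])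
        (use 2 False in \<open>simp_all add: det3_def field_simps power2_eq_square\<close>)
    qed
  next
    case 3
    then have c: "c1 = 0" "c2 = 0" using cond sums by auto
    show ?thesis unfolding c 3(2,3) using 3(1) by (rule action)
  next
    case 4
    then have c: "c1 = 0" "c2 = 0" using cond sums by auto
    show ?thesis unfolding c 4(1,3) using is_listed_iso[OF action nf_swap] 4(2) .
  next
    case 5
    consider "c1 \<noteq> 0" "c2 \<noteq> 0" | "c1 \<noteq> 0" "c2 = 0" | "c1 = 0" "c2 \<noteq> 0"
      | "c1 = 0" "c2 = 0" "c3 \<noteq> 0" | "c1 = 0" "c2 = 0" "c3 = 0"
      by blast
    then show ?thesis
    proof cases
      case 1
      show ?thesis unfolding 5
        by (rule is_listedI[OF _ nilp_3_2_eq_nf(18) nf_iso_of_base_change[of c1 0 0 0 c2 0 c3 0 "c1 * c2" 1 1]])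
        (use 1 in \<open>simp_all add: det3_def field_simps power2_eq_square\<close>)
    next
      case 2
      show ?thesis unfolding 5 2(2) using 2(1) by (rule const)
    next
      case 3
      show ?thesis unfolding 5 3(1) using is_listed_iso[OF const nf_swap] 3(2) .
    next
      case 4
      show ?thesis unfolding 5 4(1,2)
        by (rule is_listedI[OF _ nilp_3_2_eq_nf(17) nf_iso_of_base_change[of 1 0 0 0 1 0 0 0 1 1 "1 / c3"]])
        (use 4 in \<open>simp_all add: det3_def field_simps power2_eq_square\<close>)
    next
      case c: 5
      show ?thesis unfolding 5 c
        using is_listedI[OF _ nilp_3_2_eq_nf(15) superalg_iso_nf_refl] by simp
    qed
  qed
qed

text \<open>The even part is generated by e1, so a change of basis is given by the image of e1. Replacing e1 by
\<open>e1 + k e2\<close> turns e2 into \<open>e2 + 2 k e3\<close>, and k is chosen so as to move e1 into the kernel of l, if \<open>l2 \<noteq> 0\<close>, or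
else to make c proportional to the new e2, if \<open>c2 \<noteq> 0\<close>.\<close>

lemma is_listed_nf_11:
  assumes "nf_conditions 1 1 l1 l2 l3 c1 c2 c3"
  shows "is_listed (nf 1 1 l1 l2 l3 c1 c2 c3)"
proof -
  have cond: "l3 = 0" "c1 = 0" "2 * l1 * c2 = l2 * c3" "l2 * c2 = 0"
    using assms by (auto simp: nf_conditions_def)
  consider "l2 \<noteq> 0" | "l1 \<noteq> 0" "l2 = 0" | "l1 = 0" "l2 = 0" by blast
  then show ?thesis
  proof cases
    case 1
    then have c: "c2 = 0" "c3 = 0" using cond by auto
    show ?thesis unfolding cond(1,2) c
      by (rule is_listedI[OF _ nilp_3_2_eq_nf(27) nf_iso_of_base_change[of 1 0 0 "- l1 / l2" 1 0 0 "- 2 * l1 / l2" 1 "1 / l2" 1]])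
        (use 1 in \<open>simp_all add: det3_def field_simps power2_eq_square\<close>)
  next
    case 2
    then have c: "c2 = 0" using cond by auto
    show ?thesis
    proof (cases "c3 = 0")
      case True
      show ?thesis unfolding cond(1,2) c True 2(2)
        by (rule is_listedI[OF _ nilp_3_2_eq_nf(28) nf_iso_of_base_change[of 1 0 0 0 1 0 0 0 1 "1 / l1" 1]])
        (use 2 in \<open>simp_all add: det3_def field_simps power2_eq_square\<close>)
    next
      case False
      show ?thesis unfolding cond(1,2) c 2(2)
        by (rule is_listedI[OF _ nilp_3_2_eq_nf(29) nf_iso_of_base_change[of 1 0 0 0 1 0 0 0 1 "1 / l1" "1 / c3"]])
        (use 2 False in \<open>simp_all add: det3_def field_simps power2_eq_square\<close>)
    qed
  next
    case 3
    consider "c2 \<noteq> 0" | "c2 = 0" "c3 \<noteq> 0" | "c2 = 0" "c3 = 0" by blast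
    then show ?thesis
    proof cases
      case 1
      show ?thesis unfolding cond(1,2) 3
        by (rule is_listedI[OF _ nilp_3_2_eq_nf(25) nf_iso_of_base_change[of 1 0 0 "c3 / (2 * c2)" 1 0 0 "c3 / c2" 1 1 "1 / c2"]])
        (use 1 in \<open>simp_all add: det3_def field_simps power2_eq_square\<close>)
    next
      case 2
      show ?thesis unfolding cond(1,2) 3 2(1)
        by (rule is_listedI[OF _ nilp_3_2_eq_nf(26) nf_iso_of_base_change[of 1 0 0 0 1 0 0 0 1 1 "1 / c3"]])
        (use 2 in \<open>simp_all add: det3_def field_simps power2_eq_square\<close>)
    next
      case c: 3
      show ?thesis unfolding cond(1,2) 3 c
        using is_listedI[OF _ nilp_3_2_eq_nf(24) superalg_iso_nf_refl] by simp
    qed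
  qed
qed

lemma nilpotent_jordan_3_2_classification:
  assumes J: "jordan_superalgebra J" and nil: "superalg_nilpotent J" and type: "has_type J 3 2"
  shows "\<exists>n\<in>{1..29}. superalg_iso J (nilp_3_2 n)"
proof -
  obtain a b l1 l2 l3 c1 c2 c3 where ab: "a \<in> {0, 1}" "b \<in> {0, 1}"
    and iso: "superalg_iso (nf a b l1 l2 l3 c1 c2 c3) J"
    using jordan_superalgebra.nf_iso_exists[OF J nil type] .
  have "nf_conditions a b l1 l2 l3 c1 c2 c3" using nf_conditions_of_jordan[OF J nil iso] .
  then have "is_listed (nf a b l1 l2 l3 c1 c2 c3)"
    using ab is_listed_nf_00 is_listed_nf_01 is_listed_nf_10 is_listed_nf_11 by auto
  then show ?thesis
    unfolding is_listed_def using superalg_iso_sym[OF superalg_iso_trans[OF _ iso]] by blast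
qed

section \<open>Isomorphism invariants\<close>

text \<open>The first three entries determine the even part. The others describe the position of the form l and
of the vector c: whether they vanish, how they meet the products of even elements, and how they meet
the even elements of square 0.\<close>

definition signature :: "'a::ab_group_add superalg \<Rightarrow> bool list" where
  "signature A =
    [\<exists>x\<in>even_part A. \<exists>y\<in>even_part A. mul A x y \<noteq> 0,
     \<exists>x\<in>even_part A. \<exists>y\<in>even_part A. \<exists>z\<in>even_part A. mul A x (mul A y z) \<noteq> 0,
     \<exists>x\<in>even_part A. \<exists>y\<in>even_part A. mul A x x = 0 \<and> mul A x y \<noteq> 0,
     \<exists>x\<in>even_part A. \<exists>f\<in>odd_part A. mul A x f \<noteq> 0,
     \<exists>f\<in>odd_part A. \<exists>g\<in>odd_part A. mul A f g \<noteq> 0,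
     \<exists>x\<in>even_part A. \<exists>y\<in>even_part A. \<exists>f\<in>odd_part A. mul A (mul A x y) f \<noteq> 0,
     \<exists>x\<in>even_part A. \<exists>f\<in>odd_part A. \<exists>g\<in>odd_part A. mul A x (mul A f g) \<noteq> 0,
     \<exists>f\<in>odd_part A. \<exists>g\<in>odd_part A. \<exists>x\<in>even_part A. \<exists>y\<in>even_part A.
       mul A f g \<noteq> 0 \<and> mul A f g = mul A x y,
     \<exists>x\<in>even_part A. \<exists>f\<in>odd_part A. mul A x x = 0 \<and> mul A x f \<noteq> 0,
     \<exists>f\<in>odd_part A. \<exists>g\<in>odd_part A. mul A (mul A f g) (mul A f g) \<noteq> 0,
     \<exists>x\<in>even_part A. mul A x x \<noteq> 0 \<and> (\<forall>f\<in>odd_part A. mul A x f = 0)]"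

lemma signature_iso:
  assumes "superalg_iso A B"
  shows "signature A = signature B"
proof -
  from assms obtain \<phi> where lin: "Vector_Spaces.linear (smul A) (smul B) \<phi>" and bij: "bij \<phi>"
    and hom: "\<forall>x y. \<phi> (mul A x y) = mul B (\<phi> x) (\<phi> y)"
    and ev: "\<phi> ` even_part A = even_part B" and od: "\<phi> ` odd_part A = odd_part B"
    unfolding superalg_iso_def by blast
  have inj: "\<phi> x = \<phi> y \<longleftrightarrow> x = y" for x y using bij_is_inj[OF bij] by (rule inj_eq)
  have "\<phi> 0 = 0" using module_hom.zero[OF lin[folded module_hom_iff_linear]] .
  then have zero: "\<phi> x = 0 \<longleftrightarrow> x = 0" for x using inj[of x 0] by simp
  show ?thesis
    unfolding signature_def ev[symmetric] od[symmetric] bex_simps(7) ball_simps(9)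
      hom[rule_format, symmetric] inj zero ..
qed

definition evec :: "complex \<Rightarrow> complex \<Rightarrow> complex \<Rightarrow> complex ^ gen" where
  "evec x1 x2 x3 = x1 *s bv E1 + x2 *s bv E2 + x3 *s bv E3"

definition ovec :: "complex \<Rightarrow> complex \<Rightarrow> complex ^ gen" where
  "ovec f1 f2 = f1 *s bv F1 + f2 *s bv F2"

context
  fixes a b l1 l2 l3 c1 c2 c3 :: complex and A :: "(complex ^ gen) superalg"
  defines A: "A \<equiv> nf a b l1 l2 l3 c1 c2 c3"
begin

lemma even_part_nf_eq: "even_part A = {evec x1 x2 x3 | x1 x2 x3. True}"
proof (intro subset_antisym subsetI)
  fix x assume "x \<in> even_part A"
  then have "x = evec (x $ E1) (x $ E2) (x $ E3)"
    by (simp add: A even_part_nf evec_def vec_gen_eq_iff axis_def)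
  then show "x \<in> {evec x1 x2 x3 | x1 x2 x3. True}" by blast
qed (auto simp: A even_part_nf evec_def axis_def)

lemma odd_part_nf_eq: "odd_part A = {ovec f1 f2 | f1 f2. True}"
proof (intro subset_antisym subsetI)
  fix x assume "x \<in> odd_part A"
  then have "x = ovec (x $ F1) (x $ F2)"
    by (simp add: A odd_part_nf ovec_def vec_gen_eq_iff axis_def)
  then show "x \<in> {ovec f1 f2 | f1 f2. True}" by blast
qed (auto simp: A odd_part_nf ovec_def axis_def)

lemma nf_part_quantifiers:
  "(\<exists>x\<in>even_part A. P x) \<longleftrightarrow> (\<exists>x1 x2 x3. P (evec x1 x2 x3))"
  "(\<exists>x\<in>odd_part A. P x) \<longleftrightarrow> (\<exists>f1 f2. P (ovec f1 f2))"
  "(\<forall>x\<in>odd_part A. P x) \<longleftrightarrow> (\<forall>f1 f2. P (ovec f1 f2))"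
  unfolding even_part_nf_eq odd_part_nf_eq by blast+

lemma mul_nf_homogeneous:
  "mul A (evec x1 x2 x3) (evec y1 y2 y3) = evec 0 (a * (x1 * y1)) (b * (x1 * y2 + x2 * y1))"
  "mul A (evec x1 x2 x3) (ovec f1 f2) = ovec ((l1 * x1 + l2 * x2 + l3 * x3) * f2) 0"
  "mul A (ovec f1 f2) (ovec g1 g2)
    = evec (c1 * (f1 * g2 - f2 * g1)) (c2 * (f1 * g2 - f2 * g1)) (c3 * (f1 * g2 - f2 * g1))"
  by (simp_all add: A vec_gen_eq_iff mul_nf evec_def ovec_def axis_def)

lemma homogeneous_vec_eq:
  "evec x1 x2 x3 = evec y1 y2 y3 \<longleftrightarrow> x1 = y1 \<and> x2 = y2 \<and> x3 = y3"
  "evec x1 x2 x3 = 0 \<longleftrightarrow> x1 = 0 \<and> x2 = 0 \<and> x3 = 0"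
  "ovec f1 f2 = 0 \<longleftrightarrow> f1 = 0 \<and> f2 = 0"
  by (simp_all add: vec_gen_eq_iff evec_def ovec_def axis_def)

text \<open>In the proof, the arithmetic terms such as \<open>1 * 1 - 0 * 0\<close> are left unevaluated so that they match
the existential statements at the witnesses that they display.\<close>

lemma signature_nf:
  "signature A =
    [a \<noteq> 0 \<or> b \<noteq> 0,
     a \<noteq> 0 \<and> b \<noteq> 0,
     b \<noteq> 0,
     l1 \<noteq> 0 \<or> l2 \<noteq> 0 \<or> l3 \<noteq> 0,
     c1 \<noteq> 0 \<or> c2 \<noteq> 0 \<or> c3 \<noteq> 0,
     a * l2 \<noteq> 0 \<or> b * l3 \<noteq> 0,
     a * c1 \<noteq> 0 \<or> b * c1 \<noteq> 0 \<or> b * c2 \<noteq> 0,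
     (c2 \<noteq> 0 \<or> c3 \<noteq> 0) \<and> c1 = 0 \<and> (c2 = 0 \<or> a \<noteq> 0) \<and> (c3 = 0 \<or> b \<noteq> 0),
     a = 0 \<and> l1 \<noteq> 0 \<or> l2 \<noteq> 0 \<or> l3 \<noteq> 0,
     a * c1 \<noteq> 0 \<or> b * c1 * c2 \<noteq> 0,
     a \<noteq> 0 \<and> (l1 = 0 \<or> l2 \<noteq> 0 \<or> l3 \<noteq> 0)
       \<or> b \<noteq> 0 \<and> (l3 \<noteq> 0 \<or> l1 = 0 \<and> l2 = 0 \<or> l1 \<noteq> 0 \<and> l2 \<noteq> 0)]"
  unfolding signature_def nf_part_quantifiers mul_nf_homogeneous homogeneous_vec_eq list.inject
proof (intro conjI refl, goal_cases)
  case 1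
  show ?case (is "?L \<longleftrightarrow> ?R")
  proof
    assume ?R
    then have "\<not> (a * (1 * 1) = 0 \<and> b * (1 * 1 + 0 * 1) = 0)" by auto
    then show ?L by blast
  qed auto
next
  case 2
  show ?case (is "?L \<longleftrightarrow> ?R")
  proof
    assume ?R
    then have "\<not> (a * (1 * 0) = 0 \<and> b * (1 * (a * (1 * 1)) + 0 * 0) = 0)" by auto
    then show ?L by blast
  qed auto
next
  case 3
  show ?case (is "?L \<longleftrightarrow> ?R")
  proof
    assume ?R
    then have "(a * (0 * 0) = 0 \<and> b * (0 * 1 + 1 * 0) = 0) \<and> \<not> (a * (0 * 1) = 0 \<and> b * (0 * 0 + 1 * 1) = 0)"
      by auto
    then show ?L by blast
  qed auto
next
  case 4
  show ?case (is "?L \<longleftrightarrow> ?R")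
  proof
    assume ?R
    then have "(l1 * 1 + l2 * 0 + l3 * 0) * 1 \<noteq> 0 \<or> (l1 * 0 + l2 * 1 + l3 * 0) * 1 \<noteq> 0
      \<or> (l1 * 0 + l2 * 0 + l3 * 1) * 1 \<noteq> 0" by auto
    then show ?L by blast
  qed auto
next
  case 5
  show ?case (is "?L \<longleftrightarrow> ?R")
  proof
    assume ?R
    then have "\<not> (c1 * (1 * 1 - 0 * 0) = 0 \<and> c2 * (1 * 1 - 0 * 0) = 0 \<and> c3 * (1 * 1 - 0 * 0) = 0)"
      by auto
    then show ?L by blast
  qed auto
next
  case 6
  show ?case (is "?L \<longleftrightarrow> ?R")
  proof
    assume ?R
    then have "(l1 * 0 + l2 * (a * (1 * 1)) + l3 * (b * (1 * 0 + 0 * 1))) * 1 \<noteq> 0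
      \<or> (l1 * 0 + l2 * (a * (1 * 0)) + l3 * (b * (1 * 1 + 0 * 0))) * 1 \<noteq> 0" by auto
    then show ?L by blast
  qed auto
next
  case 7
  show ?case (is "?L \<longleftrightarrow> ?R")
  proof
    assume ?R
    let ?w = "1 * 1 - 0 * (0 :: complex)"
    have "\<not> (a * (1 * (c1 * ?w)) = 0 \<and> b * (1 * (c2 * ?w) + 0 * (c1 * ?w)) = 0)
      \<or> \<not> (a * (0 * (c1 * ?w)) = 0 \<and> b * (0 * (c2 * ?w) + 1 * (c1 * ?w)) = 0)" using \<open>?R\<close> by auto
    then show ?L by blast
  qed auto
next
  case 8
  show ?case (is "?L \<longleftrightarrow> ?R")
  proof
    assume ?R
    let ?w = "1 * 1 - 0 * (0 :: complex)"
    \<comment> \<open>Where a is 0, so is c2, and where b is 0, so is c3; the quotient is then 0, as it should be.\<close>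
    have "\<not> (c1 * ?w = 0 \<and> c2 * ?w = 0 \<and> c3 * ?w = 0) \<and>
      (c1 * ?w = 0 \<and> c2 * ?w = a * (1 * (c2 / a)) \<and> c3 * ?w = b * (1 * (c3 / b) + 0 * (c2 / a)))"
      using \<open>?R\<close> by auto
    then show ?L by blast
  qed auto
next
  case 9
  show ?case (is "?L \<longleftrightarrow> ?R")
  proof
    assume ?R
    then have "(a * (1 * 1) = 0 \<and> b * (1 * 0 + 0 * 1) = 0) \<and> (l1 * 1 + l2 * 0 + l3 * 0) * 1 \<noteq> 0
      \<or> (a * (0 * 0) = 0 \<and> b * (0 * 1 + 1 * 0) = 0) \<and> (l1 * 0 + l2 * 1 + l3 * 0) * 1 \<noteq> 0
      \<or> (a * (0 * 0) = 0 \<and> b * (0 * 0 + 0 * 0) = 0) \<and> (l1 * 0 + l2 * 0 + l3 * 1) * 1 \<noteq> 0" by auto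
    then show ?L by blast
  qed auto
next
  case 10
  show ?case (is "?L \<longleftrightarrow> ?R")
  proof
    assume ?R
    let ?w = "1 * 1 - 0 * (0 :: complex)"
    have "\<not> (a * ((c1 * ?w) * (c1 * ?w)) = 0
      \<and> b * ((c1 * ?w) * (c2 * ?w) + (c2 * ?w) * (c1 * ?w)) = 0)" using \<open>?R\<close> by auto
    then show ?L by blast
  qed auto
next
  case 11
  show ?case (is "?L \<longleftrightarrow> ?R")
  proof
    \<comment> \<open>An x with \<open>x1 \<noteq> 0\<close> in the kernel of l, and with \<open>x2 \<noteq> 0\<close> unless \<open>a \<noteq> 0\<close>, has a nonzero square.\<close>
    have wit: ?L if "x1 \<noteq> 0" "a \<noteq> 0 \<or> b \<noteq> 0 \<and> x2 \<noteq> 0" "l1 * x1 + l2 * x2 + l3 * x3 = 0" for x1 x2 x3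
    proof -
      have "\<not> (a * (x1 * x1) = 0 \<and> b * (x1 * x2 + x2 * x1) = 0)" using that by auto
      then show ?thesis using that(3) by (metis mult_zero_left)
    qed
    assume ?R
    then consider "a \<noteq> 0" "l1 = 0" | "a \<noteq> 0" "l2 \<noteq> 0" | "a \<noteq> 0 \<or> b \<noteq> 0" "l3 \<noteq> 0"
      | "b \<noteq> 0" "l1 = 0" "l2 = 0" | "b \<noteq> 0" "l1 \<noteq> 0" "l2 \<noteq> 0" by blast
    then show ?L
    proof cases
      case 1
      then show ?L by (intro wit[of 1 0 0]) auto
    next
      case 2
      then show ?L by (intro wit[of 1 "- l1 / l2" 0]) auto
    next
      case 3
      then show ?L by (intro wit[of 1 1 "- (l1 + l2) / l3"]) auto
    next
      case 4
      then show ?L by (intro wit[of 1 1 0]) auto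
    next
      case 5
      then show ?L by (intro wit[of "1 / l1" "- 1 / l2" 0]) auto
    qed
  next
    assume ?L
    then obtain x1 x2 x3 where x: "a * (x1 * x1) \<noteq> 0 \<or> b * (x1 * x2 + x2 * x1) \<noteq> 0"
      and "\<forall>f2. (l1 * x1 + l2 * x2 + l3 * x3) * f2 = 0" by blast
    then have "(l1 * x1 + l2 * x2 + l3 * x3) * 1 = 0" by blast
    then show ?R using x by auto
  qed
qed

end

lemma nilp_3_2_not_iso:
  assumes mn: "m \<in> {1..29}" "n \<in> {1..29}" "m \<noteq> n"
  shows "\<not> superalg_iso (nilp_3_2 m) (nilp_3_2 n)"
proof -
  let ?N = "[1, 2, 3, 4, 5, 6, 7, 8, 9, 10, 11, 12, 13, 14, 15, 16, 17, 18, 19, 20, 21, 22, 23, 24,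
      25, 26, 27, 28, 29 :: nat]"
  have "distinct (map (\<lambda>n. signature (nilp_3_2 n)) ?N)"
    unfolding list.map nilp_3_2_eq_nf signature_nf by simp
  then have inj: "inj_on (\<lambda>n. signature (nilp_3_2 n)) (set ?N)" unfolding distinct_map by blast
  have N: "k \<in> set ?N" if "k \<in> {1..29}" for k
    using that by (simp add: atLeastAtMost_iff) presburger
  have "signature (nilp_3_2 m) \<noteq> signature (nilp_3_2 n)"
    using inj_onD[OF inj _ N[OF mn(1)] N[OF mn(2)]] mn(3) by blast
  then show ?thesis using signature_iso by blast
qed

theorem theorem3p3:
  fixes J :: "'a::ab_group_add superalg"
  shows "(\<forall>n\<in>{1..29}. jordan_superalgebra (nilp_3_2 n) \<and> superalg_nilpotent (nilp_3_2 n) \<and>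
             has_type (nilp_3_2 n) 3 2)
       \<and> (\<forall>m\<in>{1..29}. \<forall>n\<in>{1..29}. m \<noteq> n \<longrightarrow> \<not> superalg_iso (nilp_3_2 m) (nilp_3_2 n))
       \<and> (jordan_superalgebra J \<and> superalg_nilpotent J \<and> has_type J 3 2 \<longrightarrow>
             (\<exists>n\<in>{1..29}. superalg_iso J (nilp_3_2 n)))"
  using nilp_3_2_nilpotent_jordan nilp_3_2_not_iso nilpotent_jordan_3_2_classification[of J] by blast

end
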